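(* Let $\alpha>0$. For any function $v\in W^{1,2}\big((0,\infty),e^{-\frac{s^2}{2}}s^{\alpha-1}ds\big)$, we have $$\int_0^\infty|v'(s)|^2e^{-s^2/2}s^{\alpha-1}ds\ge2\inf_{c\in\mathbb{R}}\int_0^\infty|v(s)-c|^2e^{-s^2/2}s^{\alpha-1}ds.$$ The constant $2$ is sharp and can be attained by the functions $v(s)=a_0+a_1s^2$ with $a_0,a_1\in\mathbb{R}$. Moreover, $$\int_0^\infty|v'(s)|^2e^{-s^2/2}s^{\alpha-1}ds-2\inf_{c\in\mathbb{R}}\int_0^\infty|v(s)-c|^2e^{-s^2/2}s^{\alpha-1}ds$$ $$\ge\frac12\inf_{d\in\mathbb{R}}\int_0^\infty|v'(s)-ds|^2e^{-s^2/2}s^{\alpha-1}ds\ \ge\ 2\inf_{c,d\in\mathbb{R}}\int_0^\infty|v(s)-c-ds^2|^2e^{-s^2/2}s^{\alpha-1}ds,$$ where in the integrands $ds$ and $ds^2$ denote the products $d\cdot s$ and $d\cdot s^2$ of the real number $d$ with $s$ and $s^2$.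
   Context: $W^{1,2}((0,\infty),\rho\,ds)$ denotes the weighted Sobolev space of real-valued functions $v$ on $(0,\infty)$ with weak derivative $v'$ such that $\int_0^\infty(|v|^2+|v'|^2)\rho\,ds<\infty$. *)

theory Defs
  imports "HOL-Analysis.Analysis"
begin

definition smooth :: "(real \<Rightarrow> real) \<Rightarrow> bool" where
  "smooth \<phi> \<longleftrightarrow> (\<forall>n. (deriv ^^ n) \<phi> differentiable_on UNIV)"

(* The space of smooth functions with compact support inside the open set S, extended by zero
   to the whole line. *)
definition test_functions :: "real set \<Rightarrow> (real \<Rightarrow> real) set" where
  "test_functions S = {\<phi>. smooth \<phi> \<and>
     compact (closure {x. \<phi> x \<noteq> 0}) \<and> closure {x. \<phi> x \<noteq> 0} \<subseteq> S}"

definition locally_integrable_on :: "(real \<Rightarrow> real) \<Rightarrow> real set \<Rightarrow> bool"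
    (infixr "locally'_integrable'_on" 46) where
  "f locally_integrable_on S \<longleftrightarrow>
     (\<forall>K. compact K \<and> K \<subseteq> S \<longrightarrow> set_integrable lebesgue K f)"

(* Intended for open S. Functions are total on the line, but only their values on S matter, and
   a weak derivative is determined only up to a null set. *)
definition has_weak_derivative_on ::
    "(real \<Rightarrow> real) \<Rightarrow> (real \<Rightarrow> real) \<Rightarrow> real set \<Rightarrow> bool" where
  "has_weak_derivative_on v v' S \<longleftrightarrow>
     v locally_integrable_on S \<and> v' locally_integrable_on S \<and>
     (\<forall>\<phi>\<in>test_functions S.
        (LINT s:S|lebesgue. v s * deriv \<phi> s) = - (LINT s:S|lebesgue. v' s * \<phi> s))"

definition weighted_sobolev12 :: "real set \<Rightarrow> (real \<Rightarrow> real) \<Rightarrow> (real \<Rightarrow> real) set" where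
  "weighted_sobolev12 S \<rho> = {v. \<exists>v'. has_weak_derivative_on v v' S \<and>
     set_integrable lebesgue S (\<lambda>s. (\<bar>v s\<bar>\<^sup>2 + \<bar>v' s\<bar>\<^sup>2) * \<rho> s)}"

definition gauss_weight :: "real \<Rightarrow> real \<Rightarrow> real" where
  "gauss_weight \<alpha> s = exp (- (s\<^sup>2 / 2)) * s powr (\<alpha> - 1)"

(* Only applied to functions f for which f * gauss_weight \<alpha> is integrable on the half-line
   (all integrals in the theorem are finite for v in the Sobolev space), so the convention that a
   Bochner integral is 0 for non-integrable functions plays no role. *)
definition gauss_integral :: "real \<Rightarrow> (real \<Rightarrow> real) \<Rightarrow> real" where
  "gauss_integral \<alpha> f = (LINT s:{0<..}|lebesgue. f s * gauss_weight \<alpha> s)"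

end

(* Write rho for the weight with parameter alpha.  By duality, a spectral gap lambda for v of mean
   zero follows from  lambda * int F^2 / rho <= int v^2 rho,  where F' = v rho and F vanishes at 0
   and at infinity: integrate by parts in  0 <= int (v' + lambda F / rho)^2 rho.  Put k = F / (s rho).
   Then v = s k' + (alpha - s^2) k, and expanding the square gives the identity
     int v^2 rho = int k'^2 s^2 rho + 2 int k^2 s^2 rho,
   where int k^2 s^2 rho = int F^2 / rho.  Dropping the first term yields the gap 2.  If v is also
   orthogonal to s^2, then k has mean zero for s^2 rho, the weight with parameter alpha + 2, and the
   gap 2 for that weight bounds the first term from below, which yields the gap 4.  All claims
   follow by splitting off the components of v along 1 and s^2 - alpha. *)

theory Submission
  imports Defs
begin

text \<open>The gaps 2 and 4 are the first two nonzero eigenvalues of the Laguerre operator -(v'' +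
  ((alpha - 1)/s - s) v'), whose eigenfunctions are polynomials in s^2; s^2 - alpha belongs to 2.
  For this function F = -s rho and k = -1, so k' = 0 and nothing is lost in the first gap. The dual
  route suits a v with only a weak derivative: k is C^1 as soon as v is continuous, so the expanded
  square is integrated by the classical fundamental theorem. The weak derivative enters only through
  its norm and through integrations by parts against C^1 functions. The obstacle is the boundary
  terms, since no decay of v at 0 or infinity is given. Cauchy-Schwarz bounds on F, and sequences
  along which s v^2 rho tends to 0, make them vanish. The factor 1/2 arises as follows. Let A be the
  squared norm of the part of v orthogonal to 1 and s^2, and K the energy of that part. The deficit
  is at least K - 2A, and the gap 4 A <= K gives K - 2A >= K/2 >= 2A.\<close>

section \<open>Integration by parts against a primitive\<close>

text \<open>The triangle inequality adds the bound up along a chain of short steps. With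
  \<open>m\<close> multiplied by an arbitrary positive factor this yields that a function is
  constant, with no differentiability at any point.\<close>

lemma increment_bound_global:
  fixes \<Phi> m :: "real \<Rightarrow> real"
  assumes "\<delta> > 0"
    and loc: "\<And>x y. \<lbrakk>a \<le> x; x \<le> y; y \<le> b; y - x < \<delta>\<rbrakk> \<Longrightarrow> \<bar>\<Phi> y - \<Phi> x\<bar> \<le> m y - m x"
    and "a \<le> b"
  shows "\<bar>\<Phi> b - \<Phi> a\<bar> \<le> m b - m a"
proof -
  have *: "\<bar>\<Phi> y - \<Phi> a\<bar> \<le> m y - m a" if "a \<le> y" "y \<le> b" "y - a \<le> real n * (\<delta>/2)" for n y
    using that
  proof (induction n arbitrary: y)
    case 0
    then show ?case using loc[of y y] \<open>\<delta> > 0\<close> by auto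
  next
    case (Suc n)
    \<comment> \<open>Half of \<open>\<delta>\<close> keeps the last step strictly shorter than
      \<open>\<delta>\<close>; the maximum stops the chain at \<open>a\<close>.\<close>
    define z where "z = max a (y - \<delta>/2)"
    have "\<bar>\<Phi> z - \<Phi> a\<bar> \<le> m z - m a"
      using Suc \<open>\<delta> > 0\<close> by (intro Suc.IH) (auto simp: z_def max_def algebra_simps)
    moreover have "\<bar>\<Phi> y - \<Phi> z\<bar> \<le> m y - m z"
      using Suc.prems \<open>\<delta> > 0\<close> by (intro loc) (auto simp: z_def max_def)
    ultimately show ?case by linarith
  qed
  obtain n where "(b - a) / (\<delta>/2) \<le> real n" using real_arch_simple by blast
  then have "b - a \<le> real n * (\<delta>/2)" using \<open>\<delta> > 0\<close> by (simp add: field_simps)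
  then show ?thesis using * \<open>a \<le> b\<close> by blast
qed

lemma absolutely_integrable_mult_continuous:
  fixes f g :: "real \<Rightarrow> real"
  assumes "f absolutely_integrable_on {a..b}" "continuous_on {a..b} g"
  shows "(\<lambda>x. f x * g x) absolutely_integrable_on {a..b}"
proof -
  have "(\<lambda>x. g x * f x) absolutely_integrable_on {a..b}"
    using assms compact_continuous_image[OF assms(2)]
    by (intro absolutely_integrable_bounded_measurable_product_real
          continuous_imp_measurable_on_sets_lebesgue compact_imp_bounded) auto
  then show ?thesis by (simp add: mult.commute)
qed

lemma continuous_on_primitive:
  fixes w V :: "real \<Rightarrow> real"
  assumes w: "w integrable_on {a..b}"
    and V: "\<And>x. x \<in> {a..b} \<Longrightarrow> V x = V a + integral {a..x} w"
  shows "continuous_on {a..b} V"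
proof -
  have "continuous_on {a..b} (\<lambda>x. V a + integral {a..x} w)"
    by (intro continuous_intros indefinite_integral_continuous_1 w)
  moreover have "continuous_on {a..b} V \<longleftrightarrow> continuous_on {a..b} (\<lambda>x. V a + integral {a..x} w)"
    by (rule continuous_on_cong[OF refl V])
  ultimately show ?thesis by blast
qed

text \<open>The increments of the difference of the two sides over an interval of length below
  \<^term>\<open>\<delta>\<close> are at most \<^term>\<open>\<epsilon>\<close> times an additive function of the interval.\<close>

lemma integral_by_parts_primitive:
  fixes w V G g :: "real \<Rightarrow> real"
  assumes "a \<le> b" and w: "w absolutely_integrable_on {a..b}"
    and V: "\<And>x. x \<in> {a..b} \<Longrightarrow> V x = V a + integral {a..x} w"
    and G: "\<And>x. x \<in> {a..b} \<Longrightarrow> (G has_real_derivative g x) (at x within {a..b})"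
    and g: "continuous_on {a..b} g"
  shows "integral {a..b} (\<lambda>x. w x * G x + V x * g x) = V b * G b - V a * G a"
proof -
  have wi: "w integrable_on {x..y}" and wai: "(\<lambda>t. \<bar>w t\<bar>) integrable_on {x..y}"
    if "a \<le> x" "y \<le> b" for x y
    using absolutely_integrable_on_subinterval[OF w, of x y] that
    by (auto simp: absolutely_integrable_on_def)
  have cV: "continuous_on {a..b} V"
    using continuous_on_primitive[OF _ V] wi by auto
  have cG: "continuous_on {a..b} G"
    using G by (meson DERIV_continuous_on)
  have h: "(\<lambda>t. w t * G t + V t * g t) integrable_on {x..y}" (is "?h integrable_on _")
    and gi: "g integrable_on {x..y}" "(\<lambda>t. \<bar>g t\<bar>) integrable_on {x..y}"
    if "a \<le> x" "y \<le> b" for x y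
  proof -
    have "?h absolutely_integrable_on {a..b}"
      by (intro set_integral_add absolutely_integrable_mult_continuous w cG
          absolutely_integrable_continuous_real continuous_intros cV g)
    then show "?h integrable_on {x..y}"
      using absolutely_integrable_on_subinterval[where f = ?h and S = "{a..b}" and a = x and b = y] that
      by (auto intro: set_lebesgue_integral_eq_integral(1))
    have "continuous_on {x..y} g" using g that by (auto intro: continuous_on_subset)
    then show "g integrable_on {x..y}" "(\<lambda>t. \<bar>g t\<bar>) integrable_on {x..y}"
      by (auto intro!: integrable_continuous_real continuous_intros)
  qed
  define m where "m x = integral {a..x} (\<lambda>t. \<bar>w t\<bar> + \<bar>g t\<bar>)" for x
  define \<Phi> where "\<Phi> x = integral {a..x} ?h - V x * G x" for x
  have "\<bar>\<Phi> b - \<Phi> a\<bar> \<le> \<epsilon> * m b" if "\<epsilon> > 0" for \<epsilon>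
  proof -
    have "uniformly_continuous_on {a..b} V" "uniformly_continuous_on {a..b} G"
      using cV cG by (auto intro: compact_uniformly_continuous)
    then obtain d1 d2 where "d1 > 0" "d2 > 0"
      and d1: "\<And>x y. \<lbrakk>x \<in> {a..b}; y \<in> {a..b}; dist y x < d1\<rbrakk> \<Longrightarrow> dist (V y) (V x) < \<epsilon>"
      and d2: "\<And>x y. \<lbrakk>x \<in> {a..b}; y \<in> {a..b}; dist y x < d2\<rbrakk> \<Longrightarrow> dist (G y) (G x) < \<epsilon>"
      using \<open>\<epsilon> > 0\<close> unfolding uniformly_continuous_on_def by metis
    have "\<bar>\<Phi> b - \<Phi> a\<bar> \<le> \<epsilon> * m b - \<epsilon> * m a"
    proof (rule increment_bound_global[where \<delta> = "min d1 d2"])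
      fix x y assume xy: "a \<le> x" "x \<le> y" "y \<le> b" "y - x < min d1 d2"
      have Vxy: "integral {x..y} w = V y - V x"
        using V[of x] V[of y] Henstock_Kurzweil_Integration.integral_combine[of a x y w] wi[of a y] xy by auto
      have Gxy: "integral {x..y} g = G y - G x"
      proof (rule integral_unique, rule fundamental_theorem_of_calculus)
        fix t assume "t \<in> {x..y}"
        then have "(G has_real_derivative g t) (at t within {x..y})"
          using G[of t] xy by (intro DERIV_subset[OF G[of t]]) auto
        then show "(G has_vector_derivative g t) (at t within {x..y})"
          by (simp add: has_real_derivative_iff_has_vector_derivative)
      qed (use xy in auto)
      have "\<Phi> y - \<Phi> x = integral {x..y} ?h - V y * G y + V x * G x"
        using Henstock_Kurzweil_Integration.integral_combine[of a x y ?h] h[of a y] xy by (auto simp: \<Phi>_def)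
      \<comment> \<open>\<open>V y * G y - V x * G x\<close> is split with \<open>G\<close> frozen
        at the left end and \<open>V\<close> at the right end. What remains of the integrand is
        \<open>w\<close> and \<open>g\<close>, each times an oscillation below
        \<open>\<epsilon>\<close>.\<close>
      also have "\<dots> = integral {x..y} ?h - G x * integral {x..y} w - V y * integral {x..y} g"
        by (simp add: Vxy Gxy algebra_simps)
      also have "\<dots> = integral {x..y} (\<lambda>t. ?h t - G x * w t - V y * g t)"
      proof -
        have "((\<lambda>t. ?h t - G x * w t - V y * g t) has_integral
               integral {x..y} ?h - G x * integral {x..y} w - V y * integral {x..y} g) {x..y}"
          using h[of x y] gi(1)[of x y] wi[of x y] xy
          by (intro has_integral_diff has_integral_mult_right integrable_integral) auto
        then show ?thesis by (rule integral_unique[symmetric])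
      qed
      finally have eq: "\<Phi> y - \<Phi> x = integral {x..y} (\<lambda>t. ?h t - G x * w t - V y * g t)" .
      have "norm (integral {x..y} (\<lambda>t. ?h t - G x * w t - V y * g t))
          \<le> integral {x..y} (\<lambda>t. \<epsilon> * (\<bar>w t\<bar> + \<bar>g t\<bar>))"
      proof (rule integral_norm_bound_integral)
        show "(\<lambda>t. ?h t - G x * w t - V y * g t) integrable_on {x..y}"
          using h[of x y] gi(1)[of x y] wi[of x y] xy by (intro integrable_diff integrable_on_mult_right) auto
        show "(\<lambda>t. \<epsilon> * (\<bar>w t\<bar> + \<bar>g t\<bar>)) integrable_on {x..y}"
          using gi(2)[of x y] wai[of x y] xy by (intro integrable_add integrable_on_mult_right) auto
        fix t assume t: "t \<in> {x..y}"
        have "\<bar>G t - G x\<bar> \<le> \<epsilon>" "\<bar>V t - V y\<bar> \<le> \<epsilon>"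
          using d1[of y t] d2[of x t] t xy by (auto simp: dist_real_def)
        then have "\<bar>w t\<bar> * \<bar>G t - G x\<bar> + \<bar>g t\<bar> * \<bar>V t - V y\<bar> \<le> \<bar>w t\<bar> * \<epsilon> + \<bar>g t\<bar> * \<epsilon>"
          by (intro add_mono mult_left_mono) auto
        moreover have "?h t - G x * w t - V y * g t = w t * (G t - G x) + g t * (V t - V y)"
          by (simp add: algebra_simps)
        moreover have "\<bar>w t * (G t - G x) + g t * (V t - V y)\<bar>
            \<le> \<bar>w t\<bar> * \<bar>G t - G x\<bar> + \<bar>g t\<bar> * \<bar>V t - V y\<bar>"
          by (rule order_trans[OF abs_triangle_ineq]) (simp add: abs_mult)
        moreover have "\<epsilon> * (\<bar>w t\<bar> + \<bar>g t\<bar>) = \<bar>w t\<bar> * \<epsilon> + \<bar>g t\<bar> * \<epsilon>"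
          by (simp add: distrib_left mult.commute)
        ultimately show "norm (?h t - G x * w t - V y * g t) \<le> \<epsilon> * (\<bar>w t\<bar> + \<bar>g t\<bar>)"
          by (simp only: real_norm_def)
      qed
      also have "\<dots> = \<epsilon> * m y - \<epsilon> * m x"
        using Henstock_Kurzweil_Integration.integral_combine[of a x y "\<lambda>t. \<bar>w t\<bar> + \<bar>g t\<bar>"]
          gi(2)[of a y] wai[of a y] xy
        by (simp add: m_def integrable_add right_diff_distrib[symmetric])
      finally show "\<bar>\<Phi> y - \<Phi> x\<bar> \<le> \<epsilon> * m y - \<epsilon> * m x" by (simp add: eq)
    qed (use \<open>d1 > 0\<close> \<open>d2 > 0\<close> \<open>a \<le> b\<close> in auto)
    then show ?thesis by (simp add: m_def)
  qed
  then have "eventually (\<lambda>\<epsilon>. \<bar>\<Phi> b - \<Phi> a\<bar> \<le> \<epsilon> * m b) (at_right 0)"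
    by (auto simp: eventually_at_filter)
  moreover have "((\<lambda>\<epsilon>. \<epsilon> * m b) \<longlongrightarrow> 0 * m b) (at_right 0)"
    by (intro tendsto_intros)
  ultimately have "\<bar>\<Phi> b - \<Phi> a\<bar> \<le> 0 * m b"
    by (intro tendsto_lowerbound) auto
  then show ?thesis by (simp add: \<Phi>_def)
qed

section \<open>Smooth bump functions\<close>

text \<open>The powers of 1/x in front of exp(-1/x) make the family closed under differentiation up
  to linear combinations.\<close>

definition flat :: "nat \<Rightarrow> real \<Rightarrow> real" where
  "flat i x = (if x > 0 then inverse x ^ i * exp (- inverse x) else 0)"

lemma flat_nonpos: "x \<le> 0 \<Longrightarrow> flat i x = 0"
  by (simp add: flat_def)

lemma flat_tendsto_0: "(flat i \<longlongrightarrow> 0) (at 0)"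
proof (rule filterlim_split_at)
  have "((\<lambda>x. inverse x ^ i / exp (inverse x)) \<longlongrightarrow> (0::real)) (at_right 0)"
    by (rule filterlim_compose[OF tendsto_power_div_exp_0 filterlim_inverse_at_top_right])
  then show "(flat i \<longlongrightarrow> 0) (at_right 0)"
    by (rule Lim_transform_eventually)
      (auto simp: flat_def eventually_at_filter exp_minus field_simps)
  show "(flat i \<longlongrightarrow> 0) (at_left 0)"
    by (rule tendsto_eventually) (auto simp: flat_def eventually_at_filter)
qed

lemma flat_has_real_derivative:
  "(flat i has_real_derivative flat (i + 2) x - real i * flat (i + 1) x) (at x)"
proof -
  consider "x > 0" | "x < 0" | "x = 0" by linarith
  then show ?thesis
  proof cases
    case 1
    have *: "real i * inverse x ^ (i - 1) * (inverse x)\<^sup>2 = real i * inverse x ^ (i + 1)"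
      by (cases i) (simp_all add: power2_eq_square)
    have d: "((\<lambda>x. inverse x ^ i * exp (- inverse x)) has_real_derivative
        (real i * inverse x ^ (i - 1) * - (inverse x)\<^sup>2) * exp (- inverse x)
          + (exp (- inverse x) * (inverse x)\<^sup>2) * inverse x ^ i) (at x)"
      using 1 by (auto intro!: derivative_eq_intros simp: power2_eq_square inverse_eq_divide)
    have "real i * inverse x ^ (i - 1) * - (inverse x)\<^sup>2 * exp (- inverse x)
        + exp (- inverse x) * (inverse x)\<^sup>2 * inverse x ^ i
      = flat (i + 2) x - real i * flat (i + 1) x"
      unfolding mult_minus_right * using 1 by (simp add: flat_def power2_eq_square algebra_simps)
    with d have "((\<lambda>x. inverse x ^ i * exp (- inverse x)) has_real_derivative
        flat (i + 2) x - real i * flat (i + 1) x) (at x)"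
      by (rule DERIV_cong)
    then show ?thesis
      by (rule has_field_derivative_transform_within_open[of _ _ _ "{0<..}"]) (use 1 in \<open>auto simp: flat_def\<close>)
  next
    case 2
    have "((\<lambda>x. 0) has_real_derivative flat (i + 2) x - real i * flat (i + 1) x) (at x)"
      using 2 by (simp add: flat_def)
    then show ?thesis
      by (rule has_field_derivative_transform_within_open[of _ _ _ "{..<0}"]) (use 2 in \<open>auto simp: flat_def\<close>)
  next
    case 3
    \<comment> \<open>The difference quotient of \<open>flat i\<close> at 0 is the next member of
      the family, so its limit is already known to be 0.\<close>
    have "(\<lambda>h. (flat i (0 + h) - flat i 0) / h) = flat (Suc i)"
      by (auto simp: flat_def fun_eq_iff field_simps)
    then show ?thesis
      using 3 flat_tendsto_0[of "Suc i"] by (simp add: DERIV_def flat_def)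
  qed
qed

text \<open>An algebra that contains the derivative of each of its members: smoothness of a member
  needs no formula for higher derivatives.\<close>

inductive_set flat_algebra :: "(real \<Rightarrow> real) set" where
  flat: "(\<lambda>x. flat i (p * x + q)) \<in> flat_algebra"
| const: "(\<lambda>x. c) \<in> flat_algebra"
| add: "f \<in> flat_algebra \<Longrightarrow> g \<in> flat_algebra \<Longrightarrow> (\<lambda>x. f x + g x) \<in> flat_algebra"
| mult: "f \<in> flat_algebra \<Longrightarrow> g \<in> flat_algebra \<Longrightarrow> (\<lambda>x. f x * g x) \<in> flat_algebra"

lemma flat_algebra_derivative:
  assumes "f \<in> flat_algebra"
  shows "\<exists>f' \<in> flat_algebra. \<forall>x. (f has_real_derivative f' x) (at x)"
  using assms
proof induction
  case (flat i p q)
  have "((\<lambda>x. flat i (p * x + q)) has_real_derivative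
      p * (flat (i + 2) (p * x + q) + (- real i) * flat (i + 1) (p * x + q))) (at x)" for x
    by (rule DERIV_chain2[OF flat_has_real_derivative, THEN DERIV_cong])
      (auto intro!: derivative_eq_intros)
  then show ?case
    by (intro bexI[of _ "\<lambda>x. p * (flat (i + 2) (p * x + q) + (- real i) * flat (i + 1) (p * x + q))"]
        flat_algebra.intros allI)
next
  case (const c)
  then show ?case
    by (intro bexI[of _ "\<lambda>x. 0"] flat_algebra.intros) auto
next
  case (add f g)
  then obtain f' g' where "f' \<in> flat_algebra" "g' \<in> flat_algebra"
    "\<And>x. (f has_real_derivative f' x) (at x)" "\<And>x. (g has_real_derivative g' x) (at x)" by blast
  then show ?case
    by (intro bexI[of _ "\<lambda>x. f' x + g' x"] flat_algebra.intros)
      (auto intro!: derivative_eq_intros)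
next
  case (mult f g)
  then obtain f' g' where *: "f' \<in> flat_algebra" "g' \<in> flat_algebra"
    "\<And>x. (f has_real_derivative f' x) (at x)" "\<And>x. (g has_real_derivative g' x) (at x)" by blast
  then show ?case
    by (intro bexI[of _ "\<lambda>x. f' x * g x + g' x * f x"] flat_algebra.intros mult)
      (auto intro!: DERIV_mult)
qed

lemma smooth_if_derivative_closed:
  assumes "f \<in> P" and "\<And>f. f \<in> P \<Longrightarrow> \<exists>f' \<in> P. \<forall>x. (f has_real_derivative f' x) (at x)"
  shows "smooth f"
proof -
  have "(deriv ^^ n) f \<in> P" for n
  proof (induction n)
    case (Suc n)
    obtain f' where "f' \<in> P" "\<forall>x. ((deriv ^^ n) f has_real_derivative f' x) (at x)"
      using assms(2)[OF Suc] by blast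
    then show ?case
      by (simp add: ext[of "deriv ((deriv ^^ n) f)" f'] DERIV_imp_deriv)
  qed (use assms in auto)
  then show ?thesis
    unfolding smooth_def differentiable_on_def
    by (metis assms(2) differentiable_at_withinI real_differentiable_def)
qed

lemma smooth_flat_algebra: "f \<in> flat_algebra \<Longrightarrow> smooth f"
  by (rule smooth_if_derivative_closed[OF _ flat_algebra_derivative])

text \<open>Serves for test functions obtained by integrating a combination of bumps, which need not
  lie in \<open>flat_algebra\<close>.\<close>

lemma smooth_antiderivative:
  assumes "\<And>x. (f has_real_derivative g x) (at x)" "smooth g"
  shows "smooth f"
proof -
  have "deriv f = g" using assms(1) by (auto simp: DERIV_imp_deriv)
  have "(deriv ^^ n) f differentiable_on UNIV" for n
  proof (cases n)
    case 0
    then show ?thesis using assms(1)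
      by (auto simp: differentiable_on_def real_differentiable_def intro: differentiable_at_withinI)
  next
    case (Suc k)
    then show ?thesis using assms(2) \<open>deriv f = g\<close>
      by (simp add: funpow_Suc_right smooth_def del: funpow.simps)
  qed
  then show ?thesis by (simp add: smooth_def)
qed

text \<open>The factors are exp(-1/(n(x-a))) and exp(-1/(n(b-x))). As n grows both tend to 1 on the
  open interval, so the bumps approximate its indicator function from below. The arguments are
  written as p * x + q to match the generators of \<open>flat_algebra\<close>.\<close>

definition bump :: "real \<Rightarrow> real \<Rightarrow> nat \<Rightarrow> real \<Rightarrow> real" where
  "bump a b n x = flat 0 (real n * x + - (real n * a)) * flat 0 (- real n * x + real n * b)"

lemma bump_flat_algebra: "bump a b n \<in> flat_algebra"
  unfolding bump_def[abs_def] by (intro flat_algebra.intros)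

lemma bump_bounds: "0 \<le> bump a b n x" "bump a b n x \<le> 1"
  by (auto simp: bump_def flat_def intro!: mult_le_one)

lemma bump_outside: "x \<notin> {a<..<b} \<Longrightarrow> bump a b n x = 0"
  by (auto simp: bump_def not_less flat_nonpos mult_left_mono)

lemma continuous_on_bump: "continuous_on S (bump a b n)"
  using flat_algebra_derivative[OF bump_flat_algebra]
  by (metis DERIV_isCont continuous_at_imp_continuous_on)

lemma bump_tendsto:
  assumes "x \<in> {a<..<b}"
  shows "(\<lambda>n. bump a b n x) \<longlonglongrightarrow> 1"
proof -
  have *: "(\<lambda>n. flat 0 (real n * c)) \<longlonglongrightarrow> 1" if "c > 0" for c
  proof -
    have "(\<lambda>n. exp (- (inverse (real n) * inverse c))) \<longlonglongrightarrow> exp (- (0 * inverse c))"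
      by (intro tendsto_intros lim_inverse_n)
    then have "(\<lambda>n. exp (- (inverse (real n) * inverse c))) \<longlonglongrightarrow> 1" by simp
    then show ?thesis
      by (rule Lim_transform_eventually)
        (use that in \<open>auto simp: flat_def eventually_sequentially intro!: exI[of _ 1]\<close>)
  qed
  have "(\<lambda>n. flat 0 (real n * (x - a)) * flat 0 (real n * (b - x))) \<longlonglongrightarrow> 1 * 1"
    by (intro tendsto_mult *) (use assms in auto)
  then show ?thesis by (simp add: bump_def algebra_simps)
qed

lemma integral_bump_tendsto:
  fixes f :: "real \<Rightarrow> real"
  assumes f: "f absolutely_integrable_on {a..b}"
  shows "(\<lambda>n. integral {a..b} (\<lambda>x. f x * bump a b n x)) \<longlonglongrightarrow> integral {a..b} f"
proof -
  \<comment> \<open>At the end points every bump is 0, so pointwise convergence to \<open>f\<close>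
    holds on the open interval only; the integrals do not see the difference.\<close>
  have "(\<lambda>n. integral {a<..<b} (\<lambda>x. f x * bump a b n x)) \<longlonglongrightarrow> integral {a<..<b} f"
  proof (rule dominated_convergence(2))
    show "(\<lambda>x. f x * bump a b n x) integrable_on {a<..<b}" for n
      using absolutely_integrable_mult_continuous[OF f continuous_on_bump]
      by (simp add: absolutely_integrable_on_def integrable_on_open_interval_real)
    show "(\<lambda>x. \<bar>f x\<bar>) integrable_on {a<..<b}"
      using f by (simp add: absolutely_integrable_on_def integrable_on_open_interval_real)
    show "norm (f x * bump a b n x) \<le> \<bar>f x\<bar>" for n x
      using bump_bounds[of a b n x] by (simp add: abs_mult mult_left_le)
    show "(\<lambda>n. f x * bump a b n x) \<longlonglongrightarrow> f x" if "x \<in> {a<..<b}" for x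
      using tendsto_mult[OF tendsto_const bump_tendsto[OF that], of "f x"] by simp
  qed
  then show ?thesis by (simp add: integral_open_interval_real)
qed

lemma set_lebesgue_integral_restrict_Icc:
  fixes g :: "real \<Rightarrow> real"
  assumes "g absolutely_integrable_on {m..M}" "{m..M} \<subseteq> S" "\<And>s. s \<in> S - {m..M} \<Longrightarrow> g s = 0"
  shows "(LINT s:S|lebesgue. g s) = integral {m..M} g"
proof -
  have "(LINT s:S|lebesgue. g s) = (LINT s:{m..M}|lebesgue. g s)"
    unfolding set_lebesgue_integral_def
    by (rule Bochner_Integration.integral_cong) (use assms in \<open>auto simp: indicator_def\<close>)
  then show ?thesis using set_lebesgue_integral_eq_integral[OF assms(1)] by simp
qed

section \<open>Weak derivatives on the half-line\<close>

text \<open>Local absolute continuity on the open half-line, encoded as being an indefinite integral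
  of \<open>w\<close>. This is the form in which integration by parts applies, and it demands
  nothing at 0 or at infinity.\<close>

definition ac_primitive :: "(real \<Rightarrow> real) \<Rightarrow> (real \<Rightarrow> real) \<Rightarrow> bool" where
  "ac_primitive V w \<longleftrightarrow> (\<forall>a b. 0 < a \<longrightarrow> a \<le> b \<longrightarrow>
     w absolutely_integrable_on {a..b} \<and> V b = V a + integral {a..b} w)"

lemma ac_primitiveD:
  assumes "ac_primitive V w" "0 < a" "a \<le> b"
  shows "w absolutely_integrable_on {a..b}" "V b = V a + integral {a..b} w"
  using assms unfolding ac_primitive_def by blast+

lemma ac_primitive_continuous:
  assumes "ac_primitive V w"
  shows "continuous_on {0<..} V"
proof -
  have "isCont V x" if "x > 0" for x
  proof -
    have "continuous_on {x/2..2*x} V"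
      using that ac_primitiveD(1)[OF assms, of "x/2" "2*x"]
      by (intro continuous_on_primitive[of w] ac_primitiveD(2)[OF assms])
        (auto simp: absolutely_integrable_on_def)
    then show ?thesis
      by (rule continuous_on_interior) (use that in auto)
  qed
  then show ?thesis by (intro continuous_at_imp_continuous_on) auto
qed

lemma ac_primitive_parts:
  assumes V: "ac_primitive V w" and ab: "0 < a" "a \<le> b"
    and G: "\<And>x. x \<in> {a..b} \<Longrightarrow> (G has_real_derivative g x) (at x)"
    and g: "continuous_on {a..b} g"
  shows "integral {a..b} (\<lambda>x. w x * G x + V x * g x) = V b * G b - V a * G a"
  using ab by (intro integral_by_parts_primitive g DERIV_subset[OF G] ac_primitiveD[OF V]) auto

lemma ac_primitive_of_derivative:
  assumes V: "\<And>x. x > 0 \<Longrightarrow> (V has_real_derivative w x) (at x)" and w: "continuous_on {0<..} w"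
  shows "ac_primitive V w"
  unfolding ac_primitive_def
proof (intro allI impI conjI)
  fix a b :: real assume ab: "0 < a" "a \<le> b"
  show "w absolutely_integrable_on {a..b}"
    by (intro absolutely_integrable_continuous_real continuous_on_subset[OF w]) (use ab in auto)
  have "(w has_integral V b - V a) {a..b}"
  proof (rule fundamental_theorem_of_calculus[OF ab(2)])
    fix x assume "x \<in> {a..b}"
    then show "(V has_vector_derivative w x) (at x within {a..b})"
      using ab V[of x]
      by (simp add: has_real_derivative_iff_has_vector_derivative has_vector_derivative_at_within)
  qed
  then show "V b = V a + integral {a..b} w" by (simp add: integral_unique)
qed

lemma locally_integrable_on_Icc:
  assumes "v locally_integrable_on {0<..}" "0 < a"
  shows "v absolutely_integrable_on {a..b}"
  using assms unfolding locally_integrable_on_def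
  by (metis atLeastAtMost_iff compact_Icc greaterThan_iff less_le_trans subsetI)

lemma ac_primitive_exists:
  assumes "w locally_integrable_on {0<..}"
  obtains V where "ac_primitive V w"
proof -
  have w: "w absolutely_integrable_on {a..b}" if "0 < a" for a b
    by (rule locally_integrable_on_Icc[OF assms that])
  then have wi: "w integrable_on {a..b}" if "0 < a" for a b
    using that by (auto simp: absolutely_integrable_on_def)
  \<comment> \<open>The base point is 1 because \<open>w\<close> need not be integrable up to
    0.\<close>
  define V where "V x = (if x \<ge> 1 then integral {1..x} w else - integral {x..1} w)" for x
  have "V b = V a + integral {a..b} w" if "0 < a" "a \<le> b" for a b
    using Henstock_Kurzweil_Integration.integral_combine[of a 1 b w]
      Henstock_Kurzweil_Integration.integral_combine[of 1 a b w]
      Henstock_Kurzweil_Integration.integral_combine[of a b 1 w] wi[of a] wi[of 1] that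
    by (auto simp: V_def)
  then show ?thesis using w that unfolding ac_primitive_def by blast
qed

section \<open>Primitives are weakly differentiable\<close>

lemma test_functionE:
  assumes "\<phi> \<in> test_functions {0<..}"
  obtains m M where "0 < m" "m \<le> M" "\<And>x. x \<notin> {m<..<M} \<Longrightarrow> \<phi> x = 0"
    "\<And>x. x \<notin> {m<..<M} \<Longrightarrow> deriv \<phi> x = 0"
    "\<And>x. (\<phi> has_real_derivative deriv \<phi> x) (at x)" "\<And>S. continuous_on S (deriv \<phi>)"
proof -
  define K where "K = closure {x. \<phi> x \<noteq> 0}"
  have K: "compact K" "K \<subseteq> {0<..}" "smooth \<phi>"
    using assms by (auto simp: test_functions_def K_def)
  have "(deriv ^^ n) \<phi> differentiable_on UNIV" for n
    using K by (auto simp: smooth_def)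
  from this[of 0] this[of 1] have d: "\<phi> differentiable (at x)" "deriv \<phi> differentiable (at x)" for x
    by (auto simp: differentiable_on_def)
  have der: "(\<phi> has_real_derivative deriv \<phi> x) (at x)" for x
    using d(1)[of x] by (simp add: DERIV_deriv_iff_real_differentiable)
  have "continuous_on S (deriv \<phi>)" for S
    using d(2) by (intro continuous_at_imp_continuous_on) (auto intro: differentiable_imp_continuous_within)
  have *: "\<phi> x = 0 \<and> deriv \<phi> x = 0" if "x \<notin> K" for x
  proof -
    have "open (- K)" unfolding K_def by (intro open_Compl closed_closure)
    moreover have "\<phi> y = 0" if "y \<in> - K" for y
      using that closure_subset[of "{x. \<phi> x \<noteq> 0}"] by (auto simp: K_def)
    ultimately have "((\<lambda>x. 0) has_real_derivative deriv \<phi> x) (at x)"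
      using der[of x] that
      by (intro has_field_derivative_transform_within_open[of \<phi> _ x "- K" "\<lambda>x. 0"]) auto
    then have "deriv \<phi> x = 0" using DERIV_unique DERIV_const by blast
    then show ?thesis using that \<open>\<And>y. y \<in> - K \<Longrightarrow> \<phi> y = 0\<close> by auto
  qed
  obtain m M where "0 < m" "m \<le> M" "K \<subseteq> {m<..<M}"
  proof (cases "K = {}")
    case False
    then obtain s t where "s \<in> K" "t \<in> K" "\<And>x. x \<in> K \<Longrightarrow> s \<le> x" "\<And>x. x \<in> K \<Longrightarrow> x \<le> t"
      using compact_attains_inf[OF K(1)] compact_attains_sup[OF K(1)] by metis
    \<comment> \<open>The margins on both sides of the support make the test function and its
      derivative vanish at the points m and M themselves, which removes the boundary terms.\<close>
    then show ?thesis using K(2)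
      by (intro that[of "s/2" "t + 1"]) fastforce+
  qed (use that[of 1 1] in auto)
  moreover from this have "x \<notin> K" if "x \<notin> {m<..<M}" for x using that by blast
  ultimately show ?thesis using * der \<open>\<And>S. continuous_on S (deriv \<phi>)\<close> by (intro that[of m M]) blast+
qed

lemma test_function_by_parts:
  assumes V: "ac_primitive V w" and \<phi>: "\<phi> \<in> test_functions {0<..}"
  shows "(LINT s:{0<..}|lebesgue. V s * deriv \<phi> s) = - (LINT s:{0<..}|lebesgue. w s * \<phi> s)"
proof -
  obtain m M where mM: "0 < m" "m \<le> M" "\<And>x. x \<notin> {m<..<M} \<Longrightarrow> \<phi> x = 0"
    "\<And>x. x \<notin> {m<..<M} \<Longrightarrow> deriv \<phi> x = 0"
    and d: "\<And>x. (\<phi> has_real_derivative deriv \<phi> x) (at x)" "\<And>S. continuous_on S (deriv \<phi>)"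
    using test_functionE[OF \<phi>] by metis
  have c: "continuous_on S \<phi>" for S
    using d(1) by (meson DERIV_isCont continuous_at_imp_continuous_on)
  have w: "(\<lambda>s. w s * \<phi> s) absolutely_integrable_on {m..M}"
    by (intro absolutely_integrable_mult_continuous ac_primitiveD[OF V] c mM)
  have v: "(\<lambda>s. V s * deriv \<phi> s) absolutely_integrable_on {m..M}"
    by (intro absolutely_integrable_continuous_real continuous_on_mult d
        continuous_on_subset[OF ac_primitive_continuous[OF V]]) (use mM in auto)
  have "integral {m..M} (\<lambda>x. w x * \<phi> x + V x * deriv \<phi> x) = V M * \<phi> M - V m * \<phi> m"
    by (rule ac_primitive_parts[OF V mM(1,2) d])
  then have "integral {m..M} (\<lambda>x. w x * \<phi> x) + integral {m..M} (\<lambda>x. V x * deriv \<phi> x) = 0"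
    using w v mM by (subst (asm) Henstock_Kurzweil_Integration.integral_add) (auto simp: absolutely_integrable_on_def)
  moreover have "(LINT s:{0<..}|lebesgue. V s * deriv \<phi> s) = integral {m..M} (\<lambda>x. V x * deriv \<phi> x)"
    by (rule set_lebesgue_integral_restrict_Icc[OF v]) (use mM in auto)
  moreover have "(LINT s:{0<..}|lebesgue. w s * \<phi> s) = integral {m..M} (\<lambda>x. w x * \<phi> x)"
    by (rule set_lebesgue_integral_restrict_Icc[OF w]) (use mM in auto)
  ultimately show ?thesis by linarith
qed

lemma ac_primitive_has_weak_derivative:
  assumes V: "ac_primitive V w"
  shows "has_weak_derivative_on V w {0<..}"
proof -
  have "f absolutely_integrable_on K" if "compact K" "K \<subseteq> {0<..}"
    "\<And>a b. 0 < a \<Longrightarrow> a \<le> b \<Longrightarrow> f absolutely_integrable_on {a..b}" for f :: "real \<Rightarrow> real" and K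
  proof (cases "K = {}")
    case False
    then obtain s t where "s \<in> K" "t \<in> K" "\<And>x. x \<in> K \<Longrightarrow> s \<le> x" "\<And>x. x \<in> K \<Longrightarrow> x \<le> t"
      using compact_attains_inf[OF \<open>compact K\<close>] compact_attains_sup[OF \<open>compact K\<close>] by metis
    then have "f absolutely_integrable_on {s..t}" "K \<subseteq> {s..t}" using that by force+
    then show ?thesis using that(1)
      by (auto intro: set_integrable_subset simp: compact_imp_closed)
  qed auto
  moreover have "V absolutely_integrable_on {a..b}" if "0 < a" for a b
    by (intro absolutely_integrable_continuous_real
        continuous_on_subset[OF ac_primitive_continuous[OF V]]) (use that in auto)
  ultimately show ?thesis
    using ac_primitiveD(1)[OF V] test_function_by_parts[OF V]
    by (simp add: has_weak_derivative_on_def locally_integrable_on_def)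
qed

section \<open>Vanishing weak derivatives, representatives and uniqueness\<close>

lemma bump_test_function:
  assumes "0 < a"
  shows "bump a b n \<in> test_functions {0<..}"
proof -
  have "closure {x. bump a b n x \<noteq> 0} \<subseteq> {a..b}"
  proof (rule closure_minimal)
    show "{x. bump a b n x \<noteq> 0} \<subseteq> {a..b}"
    proof
      fix x assume "x \<in> {x. bump a b n x \<noteq> 0}"
      then show "x \<in> {a..b}" using bump_outside[of x a b n] by (cases "x \<in> {a<..<b}") auto
    qed
  qed simp
  moreover from this have "compact (closure {x. bump a b n x \<noteq> 0})"
    by (meson bounded_closed_interval bounded_subset closed_closure compact_eq_bounded_closed)
  ultimately show ?thesis using assms smooth_flat_algebra[OF bump_flat_algebra]
    by (force simp: test_functions_def)
qed

lemma integral_bump_restrict: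
  fixes f :: "real \<Rightarrow> real"
  assumes "{a..b} \<subseteq> S"
  shows "integral S (\<lambda>x. f x * bump a b n x) = integral {a..b} (\<lambda>x. f x * bump a b n x)"
proof (rule integral_spike_set)
  have "{x \<in> S - {a..b}. f x * bump a b n x \<noteq> 0} = {}" "{x \<in> {a..b} - S. f x * bump a b n x \<noteq> 0} = {}"
    using assms bump_outside[of _ a b n] by fastforce+
  then show "negligible {x \<in> S - {a..b}. f x * bump a b n x \<noteq> 0}"
    "negligible {x \<in> {a..b} - S. f x * bump a b n x \<noteq> 0}" by (metis negligible_empty)+
qed

text \<open>Lebesgue differentiation: at almost every point the value of \<open>f\<close> is the
  limit of its means over short intervals, and these means are 0.\<close>

lemma AE_zero_of_integral_zero:
  fixes f :: "real \<Rightarrow> real"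
  assumes f: "\<And>a b. 0 < a \<Longrightarrow> a \<le> b \<Longrightarrow> f integrable_on {a..b}"
    and zero: "\<And>a b. 0 < a \<Longrightarrow> a \<le> b \<Longrightarrow> integral {a..b} f = 0"
  shows "negligible {s \<in> {0<..}. f s \<noteq> 0}"
proof -
  \<comment> \<open>The differentiation theorem is applied to functions integrable on every bounded
    interval, while \<open>f\<close> may be singular at 0. The truncations to windows exhausting the
    half-line are integrable, and their exceptional sets are countably many.\<close>
  define F where "F k x = (if x \<in> {inverse (real (Suc k))..real (Suc k)} then f x else 0)" for k x
  have "\<exists>N. negligible N \<and> (\<forall>x e. x \<notin> N \<and> 0 < e \<longrightarrow>
      (\<exists>d>0. \<forall>h. 0 < h \<and> h < d \<longrightarrow> norm (integral (cbox x (x + h *\<^sub>R One)) (F k) /\<^sub>R h ^ DIM(real) - F k x) < e))" for k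
  proof -
    have "F k integrable_on cbox a b" for a b
      unfolding F_def integrable_restrict_Int
      using f[of "max (inverse (real (Suc k))) a" "min (real (Suc k)) b"]
      by (cases "max (inverse (real (Suc k))) a \<le> min (real (Suc k)) b")
        (auto simp: less_max_iff_disj simp del: of_nat_Suc)
    then show ?thesis using integrable_ccontinuous_explicit by metis
  qed
  then obtain N where N: "\<And>k. negligible (N k)"
    "\<And>k x e. x \<notin> N k \<Longrightarrow> 0 < e \<Longrightarrow> (\<exists>d>0. \<forall>h. 0 < h \<and> h < d \<longrightarrow>
        norm (integral (cbox x (x + h *\<^sub>R One)) (F k) /\<^sub>R h ^ DIM(real) - F k x) < e)"
    by metis
  have "{s \<in> {0<..}. f s \<noteq> 0} \<subseteq> (\<Union>k. N k)"
  proof (rule subsetI, rule ccontr)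
    fix x assume "x \<in> {s \<in> {0<..}. f s \<noteq> 0}" "x \<notin> (\<Union>k. N k)"
    then have x: "x \<in> {0<..}" "f x \<noteq> 0" "x \<notin> (\<Union>k. N k)" by auto
    obtain k where k: "max x (inverse x) < real (Suc k)"
      by (meson lessI less_trans of_nat_less_iff reals_Archimedean2)
    then have xk: "inverse (real (Suc k)) \<le> x" "x < real (Suc k)"
      using x by (auto simp: field_simps simp del: of_nat_Suc)
    have "x \<notin> N k" using x by blast
    \<comment> \<open>The tolerance is the value itself: a mean of 0 cannot be closer to
      \<open>f x\<close> than \<open>\<bar>f x\<bar>\<close>.\<close>
    from N(2)[OF this, of "\<bar>f x\<bar>"] x(2) obtain d where d: "d > 0"
      "\<And>h. 0 < h \<Longrightarrow> h < d \<Longrightarrow> \<bar>integral {x..x+h} (F k) / h - F k x\<bar> < \<bar>f x\<bar>"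
      by (auto simp: divide_inverse mult.commute)
    \<comment> \<open>The second bound keeps the interval inside the window on which
      \<open>F k\<close> equals \<open>f\<close>.\<close>
    define h where "h = min (d/2) (real (Suc k) - x)"
    have h: "0 < h" "h < d" "x + h \<le> real (Suc k)" using xk d by (auto simp: h_def)
    have "integral {x..x+h} (F k) = integral {x..x+h} f"
      using xk h by (intro integral_cong) (auto simp: F_def simp del: of_nat_Suc)
    also have "\<dots> = 0" using zero x h by auto
    finally show False using d(2)[OF h(1,2)] xk by (simp add: F_def del: of_nat_Suc)
  qed
  moreover have "negligible (\<Union>k. N k)" using N(1) by (rule negligible_Union_nat)
  ultimately show ?thesis by (rule negligible_subset[rotated])
qed

text \<open>The antiderivative of a combination of two bumps with total integral zero is a test
  function; letting the bumps tend to indicator functions shows that the mean of the function over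
  an interval does not depend on the interval.\<close>

lemma du_Bois_Reymond:
  fixes f :: "real \<Rightarrow> real"
  assumes f: "\<And>a b. 0 < a \<Longrightarrow> a \<le> b \<Longrightarrow> f absolutely_integrable_on {a..b}"
    and zero: "\<And>\<phi>. \<phi> \<in> test_functions {0<..} \<Longrightarrow> (LINT s:{0<..}|lebesgue. f s * deriv \<phi> s) = 0"
  obtains c where "negligible {s \<in> {0<..}. f s \<noteq> c}"
proof -
  have *: "integral {a..b} f = (b - a) * integral {1..2} f" if ab: "0 < a" "a \<le> b" for a b
  proof -
    \<comment> \<open>The interval from 1 to 2 is the reference with which every other interval is
      compared; both lie inside the one from \<open>m\<close> to \<open>M\<close>.\<close>
    define m M where "m = min a 1" and "M = max b 2"
    have mM: "0 < m" "m \<le> M" "{a..b} \<subseteq> {m..M}" "{1..2} \<subseteq> {m..M}" using ab by (auto simp: m_def M_def)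
    define I J where "I n = integral {m..M} (\<lambda>x. 1 * bump a b n x)"
      and "J n = integral {m..M} (\<lambda>x. 1 * bump 1 2 n x)" for n
    have eq: "J n * integral {m..M} (\<lambda>x. f x * bump a b n x)
        - I n * integral {m..M} (\<lambda>x. f x * bump 1 2 n x) = 0" for n
    proof -
      \<comment> \<open>The weights are the integrals of the opposite bumps, so the total integral
        cancels and a primitive can have compact support.\<close>
      define \<psi> where "\<psi> x = J n * bump a b n x + (- I n) * bump 1 2 n x" for x
      have \<psi>: "\<psi> \<in> flat_algebra" unfolding \<psi>_def[abs_def]
        by (intro flat_algebra.intros bump_flat_algebra)
      have c\<psi>: "continuous_on S \<psi>" for S
        unfolding \<psi>_def by (intro continuous_intros continuous_on_bump)
      have out: "\<psi> x = 0" if "x \<notin> {m..M}" for x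
        using that bump_outside[of x a b n] bump_outside[of x 1 2 n] mM by (auto simp: \<psi>_def)
      obtain F where F: "\<And>x. (F has_vector_derivative \<psi> x) (at x)"
        using einterval_antiderivative[of "-\<infinity>" \<infinity> \<psi>] c\<psi>[of UNIV]
        by (auto simp: continuous_on_eq_continuous_at)
      define \<phi> where "\<phi> x = F x - F m" for x
      have \<phi>: "(\<phi> has_real_derivative \<psi> x) (at x)" for x
        using has_vector_derivative_diff[OF F has_vector_derivative_const]
        by (simp add: \<phi>_def[abs_def] has_real_derivative_iff_has_vector_derivative)
      have int: "integral {x..y} \<psi> = \<phi> y - \<phi> x" if "x \<le> y" for x y
        using that F by (intro integral_unique)
          (auto simp: \<phi>_def intro!: fundamental_theorem_of_calculus[of _ _ F, THEN has_integral_eq_rhs]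
            intro: has_vector_derivative_at_within)
      have i: "(\<lambda>x. c * bump u v n x) integrable_on {m..M}" for c u v
        by (intro integrable_continuous_real continuous_intros continuous_on_bump)
      have "integral {m..M} \<psi> = 0"
        unfolding \<psi>_def Henstock_Kurzweil_Integration.integral_add[OF i i] integral_mult_right
        by (simp add: I_def J_def)
      \<comment> \<open>\<open>\<phi>\<close> vanishes at \<open>m\<close> by its normalization and
        at \<open>M\<close> by the zero total integral; beyond these points its derivative
        \<open>\<psi>\<close> is 0.\<close>
      then have \<phi>0: "\<phi> x = 0" if "x \<notin> {m..M}" for x
      proof -
        have zero: "integral {u..v} \<psi> = 0" if "\<And>t. t \<in> {u<..<v} \<Longrightarrow> t \<notin> {m..M}" for u v
        proof -
          have "integral {u<..<v} \<psi> = integral {u<..<v} (\<lambda>_. 0)"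
            using that out by (intro integral_cong) auto
          then show ?thesis by (simp add: integral_open_interval_real)
        qed
        have "\<phi> m = 0" by (simp add: \<phi>_def)
        moreover have "\<phi> M = 0" using int[OF mM(2)] \<open>integral {m..M} \<psi> = 0\<close> \<open>\<phi> m = 0\<close> by simp
        ultimately show ?thesis
          using that int[of x m] int[of M x] zero[of x m] zero[of M x] by force
      qed
      have "closure {x. \<phi> x \<noteq> 0} \<subseteq> {m..M}"
        using \<phi>0 by (intro closure_minimal) (blast intro: ccontr, simp)
      moreover from this have "compact (closure {x. \<phi> x \<noteq> 0})"
        by (meson bounded_closed_interval bounded_subset closed_closure compact_eq_bounded_closed)
      ultimately have "\<phi> \<in> test_functions {0<..}"
        using smooth_antiderivative[OF \<phi> smooth_flat_algebra[OF \<psi>]] mM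
        by (force simp: test_functions_def)
      from zero[OF this] have "(LINT s:{0<..}|lebesgue. f s * \<psi> s) = 0"
        using DERIV_imp_deriv[OF \<phi>] by simp
      moreover have "(LINT s:{0<..}|lebesgue. f s * \<psi> s) = integral {m..M} (\<lambda>s. f s * \<psi> s)"
        by (rule set_lebesgue_integral_restrict_Icc)
          (use mM out in \<open>auto intro!: absolutely_integrable_mult_continuous f c\<psi>\<close>)
      moreover have "integral {m..M} (\<lambda>s. f s * \<psi> s) =
          J n * integral {m..M} (\<lambda>x. f x * bump a b n x) - I n * integral {m..M} (\<lambda>x. f x * bump 1 2 n x)"
      proof (rule integral_unique)
        have i: "(\<lambda>x. f x * bump u v n x) integrable_on {m..M}" for u v
          using absolutely_integrable_mult_continuous[OF f[OF mM(1,2)] continuous_on_bump]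
          by (auto simp: absolutely_integrable_on_def)
        have "((\<lambda>s. J n * (f s * bump a b n s) - I n * (f s * bump 1 2 n s)) has_integral
            J n * integral {m..M} (\<lambda>x. f x * bump a b n x) - I n * integral {m..M} (\<lambda>x. f x * bump 1 2 n x)) {m..M}"
          by (intro has_integral_diff has_integral_mult_right integrable_integral i)
        then show "((\<lambda>s. f s * \<psi> s) has_integral
            J n * integral {m..M} (\<lambda>x. f x * bump a b n x) - I n * integral {m..M} (\<lambda>x. f x * bump 1 2 n x)) {m..M}"
          by (simp add: \<psi>_def algebra_simps)
      qed
      ultimately show ?thesis by simp
    qed
    have lim: "(\<lambda>n. integral {m..M} (\<lambda>x. g x * bump u v n x)) \<longlonglongrightarrow> integral {u..v} g"
      if "g absolutely_integrable_on {u..v}" "{u..v} \<subseteq> {m..M}" for g :: "real \<Rightarrow> real" and u v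
      unfolding integral_bump_restrict[OF that(2)] by (rule integral_bump_tendsto[OF that(1)])
    have I: "I \<longlonglongrightarrow> b - a"
      using lim[where g = "\<lambda>_. 1" and u = a and v = b] ab mM unfolding I_def by (simp add: absolutely_integrable_continuous_real)
    have J: "J \<longlonglongrightarrow> 1"
      using lim[where g = "\<lambda>_. 1" and u = 1 and v = 2] mM unfolding J_def by (simp add: absolutely_integrable_continuous_real)
    have "(\<lambda>n. J n * integral {m..M} (\<lambda>x. f x * bump a b n x)
        - I n * integral {m..M} (\<lambda>x. f x * bump 1 2 n x))
      \<longlonglongrightarrow> 1 * integral {a..b} f - (b - a) * integral {1..2} f"
      by (intro tendsto_diff tendsto_mult I J lim f mM ab) auto
    then show ?thesis unfolding eq by (simp add: LIMSEQ_const_iff)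
  qed
  define c where "c = integral {1..2} f"
  have fi: "f integrable_on {a..b}" if "0 < a" "a \<le> b" for a b
    using f[OF that] by (simp add: absolutely_integrable_on_def)
  have "negligible {s \<in> {0<..}. f s - c \<noteq> 0}"
  proof (rule AE_zero_of_integral_zero)
    fix a b :: real assume ab: "0 < a" "a \<le> b"
    show "(\<lambda>s. f s - c) integrable_on {a..b}"
      using fi[OF ab] by (intro integrable_diff) auto
    show "integral {a..b} (\<lambda>s. f s - c) = 0"
      using fi[OF ab] *[OF ab] ab
      by (subst Henstock_Kurzweil_Integration.integral_diff) (auto simp: c_def)
  qed
  then show ?thesis using that[of c] by simp
qed

text \<open>A primitive of \<open>w\<close> has \<open>w\<close> as weak derivative too, so its
  difference from \<open>v\<close> has weak derivative zero and is constant almost everywhere by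
  \<open>du_Bois_Reymond\<close>.\<close>

lemma weak_derivative_representative:
  assumes v: "has_weak_derivative_on v w {0<..}"
  obtains V where "ac_primitive V w" "negligible {s \<in> {0<..}. v s \<noteq> V s}"
proof -
  have loc: "v locally_integrable_on {0<..}" "w locally_integrable_on {0<..}"
    using v by (auto simp: has_weak_derivative_on_def)
  obtain U where U: "ac_primitive U w" using ac_primitive_exists[OF loc(2)] .
  have U': "U absolutely_integrable_on {a..b}" if "0 < a" for a b
    by (intro absolutely_integrable_continuous_real
        continuous_on_subset[OF ac_primitive_continuous[OF U]]) (use that in auto)
  obtain c where c: "negligible {s \<in> {0<..}. v s - U s \<noteq> c}"
  proof (rule du_Bois_Reymond)
    show "(\<lambda>s. v s - U s) absolutely_integrable_on {a..b}" if "0 < a" for a b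
      by (intro set_integral_diff U' locally_integrable_on_Icc[OF loc(1)] that)
    fix \<phi> assume \<phi>: "\<phi> \<in> test_functions {0<..}"
    obtain m M where mM: "0 < m" "m \<le> M" "\<And>x. x \<notin> {m<..<M} \<Longrightarrow> deriv \<phi> x = 0"
      and d: "\<And>S. continuous_on S (deriv \<phi>)"
      using test_functionE[OF \<phi>] by metis
    have i: "(\<lambda>s. f s * deriv \<phi> s) absolutely_integrable_on {m..M}"
      if "f absolutely_integrable_on {m..M}" for f
      by (rule absolutely_integrable_mult_continuous[OF that d])
    have r: "(LINT s:{0<..}|lebesgue. f s * deriv \<phi> s) = integral {m..M} (\<lambda>s. f s * deriv \<phi> s)"
      if "f absolutely_integrable_on {m..M}" for f
      by (rule set_lebesgue_integral_restrict_Icc[OF i[OF that]]) (use mM in auto)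
    note iv = locally_integrable_on_Icc[OF loc(1) mM(1), of M] and iU = U'[OF mM(1), of M]
    have "(LINT s:{0<..}|lebesgue. (v s - U s) * deriv \<phi> s)
        = integral {m..M} (\<lambda>s. v s * deriv \<phi> s - U s * deriv \<phi> s)"
      unfolding r[OF set_integral_diff(1)[OF iv iU]] by (simp add: left_diff_distrib)
    also have "\<dots> = integral {m..M} (\<lambda>s. v s * deriv \<phi> s) - integral {m..M} (\<lambda>s. U s * deriv \<phi> s)"
      using i[OF iv] i[OF iU] by (intro Henstock_Kurzweil_Integration.integral_diff) (auto simp: absolutely_integrable_on_def)
    also have "\<dots> = (LINT s:{0<..}|lebesgue. v s * deriv \<phi> s) - (LINT s:{0<..}|lebesgue. U s * deriv \<phi> s)"
      by (simp add: r iv iU)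
    also have "\<dots> = 0"
      using v \<phi> test_function_by_parts[OF U \<phi>] by (simp add: has_weak_derivative_on_def)
    finally show "(LINT s:{0<..}|lebesgue. (v s - U s) * deriv \<phi> s) = 0" .
  qed
  show ?thesis
  proof
    show "ac_primitive (\<lambda>s. U s + c) w"
      using U unfolding ac_primitive_def by (metis add.assoc add.commute)
    have "{s \<in> {0<..}. v s \<noteq> U s + c} = {s \<in> {0<..}. v s - U s \<noteq> c}" by auto
    then show "negligible {s \<in> {0<..}. v s \<noteq> U s + c}" using c by simp
  qed
qed

text \<open>Testing with bumps and passing to the limit shows that both functions have the same
  integral over every interval. The theorem speaks of every weak derivative of \<open>v\<close>,
  whereas membership in the Sobolev space provides some weak derivative with finite energy; this
  identifies the two.\<close>

lemma weak_derivative_unique: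
  assumes w: "has_weak_derivative_on v w {0<..}" and w': "has_weak_derivative_on v w' {0<..}"
  shows "negligible {s \<in> {0<..}. w s \<noteq> w' s}"
proof -
  have loc: "w locally_integrable_on {0<..}" "w' locally_integrable_on {0<..}"
    using w w' by (auto simp: has_weak_derivative_on_def)
  note i = locally_integrable_on_Icc[OF loc(1)] locally_integrable_on_Icc[OF loc(2)]
  have "negligible {s \<in> {0<..}. w s - w' s \<noteq> 0}"
  proof (rule AE_zero_of_integral_zero)
    fix a b :: real assume ab: "0 < a" "a \<le> b"
    have d: "(\<lambda>s. w s - w' s) absolutely_integrable_on {a..b}"
      by (intro set_integral_diff i ab)
    then show "(\<lambda>s. w s - w' s) integrable_on {a..b}" by (simp add: absolutely_integrable_on_def)
    have "integral {a..b} (\<lambda>s. (w s - w' s) * bump a b n s) = 0" for n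
    proof -
      have m: "(\<lambda>s. f s * bump a b n s) absolutely_integrable_on {a..b}"
        if "f absolutely_integrable_on {a..b}" for f
        by (rule absolutely_integrable_mult_continuous[OF that continuous_on_bump])
      have r: "(LINT s:{0<..}|lebesgue. f s * bump a b n s) = integral {a..b} (\<lambda>s. f s * bump a b n s)"
        if "f absolutely_integrable_on {a..b}" for f
        by (rule set_lebesgue_integral_restrict_Icc[OF m[OF that]]) (use ab in \<open>auto intro: bump_outside\<close>)
      have "integral {a..b} (\<lambda>s. w s * bump a b n s) = integral {a..b} (\<lambda>s. w' s * bump a b n s)"
        using w w' bump_test_function[OF ab(1), of b n] r[OF i(1)[OF ab(1)]] r[OF i(2)[OF ab(1)]]
        unfolding has_weak_derivative_on_def by force
      then show ?thesis
        using m[OF i(1)[OF ab(1)]] m[OF i(2)[OF ab(1)]]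
        by (simp add: left_diff_distrib Henstock_Kurzweil_Integration.integral_diff absolutely_integrable_on_def)
    qed
    then show "integral {a..b} (\<lambda>s. w s - w' s) = 0"
      using integral_bump_tendsto[OF d] by (simp add: LIMSEQ_const_iff)
  qed
  then show ?thesis by simp
qed

section \<open>Measurability and improper integrals on the half-line\<close>

lemma borel_measurable_pos_of_Icc:
  fixes w :: "real \<Rightarrow> real"
  assumes w: "\<And>a b. 0 < a \<Longrightarrow> a \<le> b \<Longrightarrow> w absolutely_integrable_on {a..b}"
  shows "w \<in> borel_measurable (lebesgue_on {0<..})"
proof -
  define W where "W n x = indicator {inverse (real (Suc n))..real (Suc n)} x *\<^sub>R w x" for n x
  have W: "W n \<in> borel_measurable lebesgue" for n
  proof -
    have "inverse (real (Suc n)) \<le> real (Suc n)"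
      by (metis inverse_le_1_iff le_add1 of_nat_1 of_nat_le_iff order.trans plus_1_eq_Suc)
    then have "w absolutely_integrable_on {inverse (real (Suc n))..real (Suc n)}"
      by (intro w) simp
    then show ?thesis unfolding W_def set_integrable_def by (rule borel_measurable_integrable)
  qed
  have lim: "(\<lambda>n. W n x) \<longlonglongrightarrow> w x" if "x \<in> {0<..}" for x
  proof (rule tendsto_eventually)
    obtain k where k: "max x (inverse x) < real k" using reals_Archimedean2 by blast
    have "W n x = w x" if "n \<ge> k" for n
    proof -
      have "x < real (Suc n)" "inverse x < real (Suc n)" using k that by auto
      then have "inverse (real (Suc n)) \<le> x" using \<open>x \<in> {0<..}\<close> by (simp add: field_simps del: of_nat_Suc)
      then show ?thesis using \<open>x < real (Suc n)\<close> by (simp add: W_def del: of_nat_Suc)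
    qed
    then show "\<forall>\<^sub>F n in sequentially. W n x = w x" by (auto simp: eventually_sequentially)
  qed
  show ?thesis
    by (rule borel_measurable_LIMSEQ_real[where u = W])
      (use lim W in \<open>auto intro: measurable_restrict_space1\<close>)
qed

lemma ac_primitive_borel_measurable:
  assumes "ac_primitive V w"
  shows "w \<in> borel_measurable (lebesgue_on {0<..})"
  by (rule borel_measurable_pos_of_Icc) (rule ac_primitiveD[OF assms])

text \<open>Dominated convergence gives both limits. The lemma supplies the dual primitive
  \<open>F\<close>, the running energy of \<open>v\<close>, and the passage from bounded intervals
  to the half-line in \<open>gauss_parts\<close>.\<close>

lemma integral_initial_segment:
  fixes f :: "real \<Rightarrow> real"
  assumes f: "f absolutely_integrable_on {0<..}"
  defines "T \<equiv> \<lambda>x. integral {0<..x} f"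
  shows "ac_primitive T f" "(T \<longlongrightarrow> 0) (at_right 0)" "(T \<longlongrightarrow> integral {0<..} f) at_top"
proof -
  have fs: "f absolutely_integrable_on S" if "S \<subseteq> {0<..}" "S \<in> sets lebesgue" for S
    using set_integrable_subset[OF f] that by auto
  have "T b = T a + integral {a..b} f" if ab: "0 < a" "a \<le> b" for a b
  proof -
    have "integral ({0<..a} \<union> {a..b}) f = integral {0<..a} f + integral {a..b} f"
    proof (rule Henstock_Kurzweil_Integration.integral_Un)
      show "f integrable_on {0<..a}" "f integrable_on {a..b}"
        using fs[of "{0<..a}"] fs[of "{a..b}"] ab by (auto simp: absolutely_integrable_on_def subset_iff)
      have "{0<..a} \<inter> {a..b} = {a}" using ab by auto
      then show "negligible ({0<..a} \<inter> {a..b})" by simp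
    qed
    moreover have "{0<..a} \<union> {a..b} = {0<..b}" using ab by auto
    ultimately show ?thesis by (simp add: T_def)
  qed
  moreover have "f absolutely_integrable_on {a..b}" if "0 < a" for a b
    using that by (intro fs) auto
  ultimately show "ac_primitive T f" unfolding ac_primitive_def by blast
  have T: "T x = integral {0<..} (\<lambda>t. if t \<le> x then f t else 0)" for x
  proof -
    have "integral {0<..} (\<lambda>t. if t \<in> {..x} then f t else 0) = integral ({..x} \<inter> {0<..}) f"
      by (rule integral_restrict_Int)
    moreover have "{..x} \<inter> {0<..} = {0<..x}" by auto
    ultimately show ?thesis by (simp add: T_def)
  qed
  have fi: "(\<lambda>t. if t \<le> x then f t else 0) integrable_on {0<..}" for x
  proof -
    have "{..x} \<inter> {0<..} = {0<..x}" by auto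
    then have "(\<lambda>t. if t \<in> {..x} then f t else 0) integrable_on {0<..}"
      unfolding integrable_restrict_Int using fs[of "{0<..x}"] by (auto simp: absolutely_integrable_on_def)
    then show ?thesis by simp
  qed
  have fa: "(\<lambda>x. \<bar>f x\<bar>) integrable_on {0<..}" using f by (simp add: absolutely_integrable_on_def)
  have lim: "(\<lambda>n. T (X n)) \<longlonglongrightarrow> integral {0<..} g"
    if "\<And>t. t > 0 \<Longrightarrow> (\<lambda>n. if t \<le> X n then f t else 0) \<longlonglongrightarrow> g t" for X g
    unfolding T by (rule dominated_convergence(2)[OF fi fa]) (use that in auto)
  show "(T \<longlongrightarrow> 0) (at_right 0)"
    unfolding tendsto_at_iff_sequentially comp_def
  proof (intro allI impI)
    fix X :: "nat \<Rightarrow> real" assume X: "\<forall>i. X i \<in> {0<..} - {0}" "X \<longlonglongrightarrow> 0"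
    have "(\<lambda>n. T (X n)) \<longlonglongrightarrow> integral {0<..} (\<lambda>_::real. 0::real)"
    proof (rule lim, rule tendsto_eventually)
      fix t :: real assume "t > 0"
      have "\<forall>\<^sub>F n in sequentially. X n < t" by (rule order_tendstoD(2)[OF X(2) \<open>t > 0\<close>])
      then show "\<forall>\<^sub>F n in sequentially. (if t \<le> X n then f t else 0) = 0"
        by eventually_elim auto
    qed
    then show "(\<lambda>n. T (X n)) \<longlonglongrightarrow> 0" by simp
  qed
  show "(T \<longlongrightarrow> integral {0<..} f) at_top"
  proof (rule tendsto_at_topI_sequentially)
    fix X :: "nat \<Rightarrow> real" assume X: "filterlim X at_top sequentially"
    show "(\<lambda>n. T (X n)) \<longlonglongrightarrow> integral {0<..} f"
    proof (rule lim, rule tendsto_eventually)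
      fix t :: real
      have "\<forall>\<^sub>F n in sequentially. t \<le> X n" using X by (simp add: filterlim_at_top)
      then show "\<forall>\<^sub>F n in sequentially. (if t \<le> X n then f t else 0) = f t"
        by eventually_elim auto
    qed
  qed
qed

lemma ac_primitive_has_real_derivative:
  assumes V: "ac_primitive V w" and w: "continuous_on {0<..} w" and "x > 0"
  shows "(V has_real_derivative w x) (at x)"
proof -
  have "((\<lambda>u. integral {x/2..u} w) has_real_derivative w x) (at x within {x/2..2*x})"
    using \<open>x > 0\<close> by (intro integral_has_real_derivative continuous_on_subset[OF w]) auto
  then have "((\<lambda>u. V (x/2) + integral {x/2..u} w) has_real_derivative w x) (at x)"
    using \<open>x > 0\<close> at_within_Icc_at[of "x/2" x "2*x"]
    by (auto intro!: derivative_eq_intros)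
  then show ?thesis
  proof (rule has_field_derivative_transform_within_open[of _ _ _ "{x/2<..}"])
    show "V (x/2) + integral {x/2..y} w = V y" if "y \<in> {x/2<..}" for y
      using ac_primitiveD(2)[OF V, of "x/2" y] that \<open>x > 0\<close> by auto
  qed (use \<open>x > 0\<close> in auto)
qed

text \<open>For a nonnegative integrand, integrability comes from the existence of the two limits of
  \<open>G\<close>. In \<open>dual_identity\<close> this is how \<open>k\<close> and its derivative
  are found to be square integrable.\<close>

lemma improper_FTC_nonneg:
  fixes f G :: "real \<Rightarrow> real"
  assumes G: "\<And>x. x > 0 \<Longrightarrow> (G has_real_derivative f x) (at x)" and f: "continuous_on {0<..} f"
    and nn: "\<And>x. x > 0 \<Longrightarrow> 0 \<le> f x"
    and A: "(G \<longlongrightarrow> A) (at_right 0)" and B: "(G \<longlongrightarrow> B) at_top"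
  shows "f absolutely_integrable_on {0<..}" "integral {0<..} f = B - A"
proof -
  have c: "isCont f x" if "x > 0" for x
    using f that by (simp add: continuous_on_eq_continuous_at)
  have e: "einterval 0 \<infinity> = {0<..}" by (auto simp: einterval_def zero_ereal_def)
  have A': "((G \<circ> real_of_ereal) \<longlongrightarrow> A) (at_right 0)"
    using A by (simp add: zero_ereal_def ereal_tendsto_simps)
  have B': "((G \<circ> real_of_ereal) \<longlongrightarrow> B) (at_left \<infinity>)"
    using B by (simp add: ereal_tendsto_simps)
  have S: "set_integrable lborel {0<..} f"
    using interval_integral_FTC_nonneg(1)[of 0 \<infinity> G f A B, unfolded e] G c nn A' B'
    by (auto simp: zero_ereal_def)
  then show abs: "f absolutely_integrable_on {0<..}"
    by (auto simp: set_integrable_def integrable_completion)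
  have "(LBINT x=0..\<infinity>. f x) = B - A"
    using interval_integral_FTC_nonneg(2)[of 0 \<infinity> G f A B] G c nn A' B' by (auto simp: zero_ereal_def)
  then have "(LINT x:{0<..}|lborel. f x) = B - A"
    by (simp add: interval_lebesgue_integral_def e)
  moreover have "(LINT x:{0<..}|lborel. f x) = integral {0<..} f"
    by (rule set_borel_integral_eq_integral(2)[OF S])
  ultimately show "integral {0<..} f = B - A" by simp
qed

text \<open>Since \<^term>\<open>\<lambda>s. 1 / s\<close> is integrable neither at \<open>0\<close> nor at infinity, an integrable function
  is much smaller than \<open>1 / s\<close> along suitable sequences.\<close>

lemma integrable_small_along_sequences:
  fixes q :: "real \<Rightarrow> real"
  assumes q: "q absolutely_integrable_on {0<..}" and nn: "\<And>s. s > 0 \<Longrightarrow> 0 \<le> q s"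
  obtains a b where "\<And>n. a n > 0" "a \<longlonglongrightarrow> 0" "(\<lambda>n. a n * q (a n)) \<longlonglongrightarrow> 0"
    "\<And>n. b n > 0" "filterlim b at_top sequentially" "(\<lambda>n. b n * q (b n)) \<longlonglongrightarrow> 0"
proof -
  define I where "I = integral {0<..} q"
  have qs: "q integrable_on {x..y}" if "0 < x" for x y
    using set_integrable_subset[OF q, of "{x..y}"] that by (auto simp: absolutely_integrable_on_def subset_iff)
  \<comment> \<open>If s q(s) stays above \<open>e\<close> on an interval, the integral of
    \<open>q\<close> there is at least that of e/s, which grows logarithmically.\<close>
  have *: "e * (ln y - ln x) \<le> I" if "0 < x" "x \<le> y" "\<And>s. s \<in> {x..y} \<Longrightarrow> e \<le> s * q s" for x y e
  proof -
    have "((\<lambda>s. e * inverse s) has_integral e * ln y - e * ln x) {x..y}"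
      using that by (intro fundamental_theorem_of_calculus)
        (auto intro!: derivative_eq_intros simp: divide_inverse
          simp flip: has_real_derivative_iff_has_vector_derivative)
    then have "e * ln y - e * ln x \<le> integral {x..y} q"
      using qs[OF that(1), of y] that
      by (intro has_integral_le[OF _ integrable_integral]) (auto simp: field_simps)
    also have "\<dots> \<le> I"
      unfolding I_def using that(1) qs[OF that(1)] q nn
      by (intro integral_subset_le) (auto simp: absolutely_integrable_on_def)
    finally show ?thesis by (simp add: algebra_simps)
  qed
  have I0: "0 \<le> I" unfolding I_def using q nn by (intro integral_nonneg) (auto simp: absolutely_integrable_on_def)
  have "\<exists>s. 0 < s \<and> s < inverse (real (Suc n)) \<and> s * q s < inverse (real (Suc n))" for n
  proof (rule ccontr)
    define e y where "e = inverse (real (Suc n))" and "y = e / 2"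
    \<comment> \<open>Chosen so that \<open>e * (ln y - ln x)\<close> is \<open>I + 1\<close>, one
      more than the whole integral allows.\<close>
    define x where "x = y * exp (- ((I + 1) / e))"
    assume "\<not> ?thesis"
    then have h: "e \<le> s * q s" if "0 < s" "s < e" for s using that by (force simp: e_def)
    have ey: "e > 0" "y > 0" "y < e" by (auto simp: e_def y_def)
    then have "0 < x" "x \<le> y" using I0 by (auto simp: x_def)
    moreover have "e * (ln y - ln x) = I + 1" using ey by (simp add: x_def ln_mult)
    ultimately show False using *[of x y e] h ey by fastforce
  qed
  then obtain a where a: "\<And>n. 0 < a n" "\<And>n. a n < inverse (real (Suc n))"
    "\<And>n. a n * q (a n) < inverse (real (Suc n))" by metis
  have "\<exists>s. real (Suc n) < s \<and> s * q s < inverse (real (Suc n))" for n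
  proof (rule ccontr)
    define e x where "e = inverse (real (Suc n))" and "x = real (Suc n) + 1"
    define y where "y = x * exp ((I + 1) / e)"
    assume "\<not> ?thesis"
    then have h: "e \<le> s * q s" if "real (Suc n) < s" for s using that by (force simp: e_def)
    have ey: "e > 0" "x > 0" by (auto simp: e_def x_def)
    then have "x \<le> y" using I0 by (auto simp: y_def)
    moreover have "e * (ln y - ln x) = I + 1" using ey by (simp add: y_def ln_mult)
    moreover have "e \<le> s * q s" if "s \<in> {x..y}" for s using h[of s] that by (auto simp: x_def)
    ultimately show False using *[of x y e] ey by fastforce
  qed
  then obtain b where b: "\<And>n. real (Suc n) < b n" "\<And>n. b n * q (b n) < inverse (real (Suc n))" by metis
  have b0: "b n > 0" for n using b(1)[of n] by (meson less_trans of_nat_0_less_iff zero_less_Suc)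
  have nn': "0 \<le> a n * q (a n)" "0 \<le> b n * q (b n)" for n
    using nn[OF a(1)] nn[OF b0] a(1)[of n] b0[of n] by (auto intro: mult_nonneg_nonneg less_imp_le)
  show ?thesis
  proof
    show "a \<longlonglongrightarrow> 0"
      by (rule tendsto_sandwich[OF _ _ tendsto_const LIMSEQ_inverse_real_of_nat])
        (use a in \<open>auto intro!: always_eventually less_imp_le simp del: of_nat_Suc\<close>)
    show "(\<lambda>n. a n * q (a n)) \<longlonglongrightarrow> 0"
      by (rule tendsto_sandwich[OF _ _ tendsto_const LIMSEQ_inverse_real_of_nat])
        (use a nn' in \<open>auto intro!: always_eventually intro: less_imp_le mult_nonneg_nonneg simp del: of_nat_Suc\<close>)
    show "(\<lambda>n. b n * q (b n)) \<longlonglongrightarrow> 0"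
      by (rule tendsto_sandwich[OF _ _ tendsto_const LIMSEQ_inverse_real_of_nat])
        (use b nn' in \<open>auto intro!: always_eventually intro: less_imp_le mult_nonneg_nonneg simp del: of_nat_Suc\<close>)
    show "filterlim b at_top sequentially"
      by (rule filterlim_at_top_mono[OF filterlim_real_sequentially])
        (use b(1) in \<open>intro always_eventually allI, smt (verit) of_nat_Suc\<close>)
  qed (use a b0 in auto)
qed

section \<open>The Gaussian weight\<close>

lemma gauss_weight_pos: "s > 0 \<Longrightarrow> gauss_weight \<beta> s > 0"
  by (simp add: gauss_weight_def)

lemma gauss_weight_nonneg: "0 \<le> gauss_weight \<beta> s"
  by (simp add: gauss_weight_def)

lemma gauss_weight_continuous: "continuous_on {0<..} (gauss_weight \<beta>)"
  unfolding gauss_weight_def by (intro continuous_intros) auto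

lemma gauss_weight_add_2: "s > 0 \<Longrightarrow> gauss_weight (\<beta> + 2) s = s\<^sup>2 * gauss_weight \<beta> s"
  using powr_add[of s "\<beta> - 1" 2] by (simp add: gauss_weight_def add_diff_eq add.commute)

text \<open>This formula produces the eigenfunction: s^2 - beta times the weight is minus a
  derivative, so its dual primitive is explicit. Its sign change at the square root of beta also
  governs all tail estimates below.\<close>

lemma gauss_weight_times_id_derivative:
  assumes "s > 0"
  shows "((\<lambda>s. s * gauss_weight \<beta> s) has_real_derivative (\<beta> - s\<^sup>2) * gauss_weight \<beta> s) (at s)"
proof -
  have "s * s powr (\<beta> - 2) = s powr (\<beta> - 1)"
    using assms powr_add[of s 1 "\<beta> - 2"] by simp
  then have *: "s * (s powr (\<beta> - 2) * a) = s powr (\<beta> - 1) * a" for a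
    by (simp flip: mult.assoc)
  show ?thesis
    unfolding gauss_weight_def using assms
    by (auto intro!: derivative_eq_intros simp: algebra_simps power2_eq_square *)
qed

text \<open>Comparison with the Gamma integrand: (t - 1)^2 >= 0 gives -t^2/2 <= 1/2 - t, so a
  constant multiple of t^(beta - 1) exp(-t) dominates.\<close>

lemma gauss_weight_absolutely_integrable:
  assumes "\<beta> > 0"
  shows "gauss_weight \<beta> absolutely_integrable_on {0<..}"
proof (rule measurable_bounded_by_integrable_imp_absolutely_integrable)
  show "gauss_weight \<beta> \<in> borel_measurable (lebesgue_on {0<..})"
    by (intro continuous_imp_measurable_on_sets_lebesgue gauss_weight_continuous) auto
  have "(\<lambda>t. norm (complex_of_real t powr (of_real \<beta> - 1) / of_real (exp t))) integrable_on {0<..}"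
    using absolutely_integrable_Gamma_integral'[of "of_real \<beta>"] assms
    by (simp add: absolutely_integrable_on_def)
  then have "(\<lambda>t. t powr (\<beta> - 1) / exp t) integrable_on {0<..}"
    by (rule integrable_eq) (auto simp: norm_divide norm_powr_real_powr)
  then show "(\<lambda>t. exp (1/2) * (t powr (\<beta> - 1) / exp t)) integrable_on {0<..}"
    by (rule integrable_on_mult_right)
  fix t :: real
  have "0 \<le> (t - 1)\<^sup>2" by simp
  then have "- (t\<^sup>2 / 2) \<le> 1 / 2 - t" by (simp add: power2_eq_square algebra_simps)
  then have "exp (- (t\<^sup>2 / 2)) \<le> exp (1/2) / exp t" by (simp flip: exp_diff)
  then show "norm (gauss_weight \<beta> t) \<le> exp (1/2) * (t powr (\<beta> - 1) / exp t)"
    using mult_right_mono[of "exp (- (t\<^sup>2 / 2))" _ "t powr (\<beta> - 1)"]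
    by (fastforce simp: gauss_weight_def abs_mult)
qed auto

section \<open>The weighted space of square integrable functions\<close>

definition gauss_L2 :: "real \<Rightarrow> (real \<Rightarrow> real) set" where
  "gauss_L2 \<beta> = {f \<in> borel_measurable (lebesgue_on {0<..}).
     (\<lambda>s. (f s)\<^sup>2 * gauss_weight \<beta> s) absolutely_integrable_on {0<..}}"

text \<open>Written with the gauge integral, to which the calculus above applies;
  \<open>gauss_integral_square\<close> translates to the Lebesgue integral of the theorem.\<close>

definition gauss_inner :: "real \<Rightarrow> (real \<Rightarrow> real) \<Rightarrow> (real \<Rightarrow> real) \<Rightarrow> real" where
  "gauss_inner \<beta> f g = integral {0<..} (\<lambda>s. f s * g s * gauss_weight \<beta> s)"

lemma gauss_weight_measurable: "gauss_weight \<beta> \<in> borel_measurable (lebesgue_on {0<..})"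
  by (intro continuous_imp_measurable_on_sets_lebesgue gauss_weight_continuous) auto

lemma gauss_L2_measurable: "f \<in> gauss_L2 \<beta> \<Longrightarrow> f \<in> borel_measurable (lebesgue_on {0<..})"
  by (simp add: gauss_L2_def)

lemma gauss_L2_I:
  assumes "f \<in> borel_measurable (lebesgue_on {0<..})" "g integrable_on {0<..}"
    "\<And>s. s > 0 \<Longrightarrow> (f s)\<^sup>2 * gauss_weight \<beta> s \<le> g s"
  shows "f \<in> gauss_L2 \<beta>"
  unfolding gauss_L2_def
proof (intro CollectI conjI assms(1) measurable_bounded_by_integrable_imp_absolutely_integrable[OF _ _ assms(2)])
  show "(\<lambda>s. (f s)\<^sup>2 * gauss_weight \<beta> s) \<in> borel_measurable (lebesgue_on {0<..})"
    by (intro borel_measurable_times borel_measurable_power assms gauss_weight_measurable)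
  show "norm ((f s)\<^sup>2 * gauss_weight \<beta> s) \<le> g s" if "s \<in> {0<..}" for s
    using assms(3)[of s] gauss_weight_pos[of s \<beta>] that by (simp add: abs_mult)
qed auto

lemma gauss_L2_mult:
  assumes f: "f \<in> gauss_L2 \<beta>" and g: "g \<in> gauss_L2 \<beta>"
  shows "(\<lambda>s. f s * g s * gauss_weight \<beta> s) absolutely_integrable_on {0<..}"
proof (rule measurable_bounded_by_integrable_imp_absolutely_integrable)
  show "(\<lambda>s. f s * g s * gauss_weight \<beta> s) \<in> borel_measurable (lebesgue_on {0<..})"
    by (intro borel_measurable_times gauss_L2_measurable[OF f] gauss_L2_measurable[OF g] gauss_weight_measurable)
  show "(\<lambda>s. (f s)\<^sup>2 * gauss_weight \<beta> s + (g s)\<^sup>2 * gauss_weight \<beta> s) integrable_on {0<..}"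
    using f g by (intro integrable_add) (auto simp: gauss_L2_def absolutely_integrable_on_def)
  fix s :: real assume s: "s \<in> {0<..}"
  have "\<bar>f s * g s\<bar> \<le> (f s)\<^sup>2 + (g s)\<^sup>2"
  proof -
    have "2 * \<bar>f s * g s\<bar> \<le> (f s)\<^sup>2 + (g s)\<^sup>2"
      using sum_squares_bound[of "\<bar>f s\<bar>" "\<bar>g s\<bar>"] by (simp add: abs_mult mult.assoc)
    then show ?thesis using abs_ge_zero[of "f s * g s"] by linarith
  qed
  then show "norm (f s * g s * gauss_weight \<beta> s) \<le> (f s)\<^sup>2 * gauss_weight \<beta> s + (g s)\<^sup>2 * gauss_weight \<beta> s"
    using gauss_weight_pos[of s \<beta>] s mult_right_mono[of "\<bar>f s * g s\<bar>" _ "gauss_weight \<beta> s"]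
    by (fastforce simp: abs_mult distrib_right)
qed auto

lemma gauss_L2_add:
  assumes f: "f \<in> gauss_L2 \<beta>" and g: "g \<in> gauss_L2 \<beta>"
  shows "(\<lambda>s. f s + g s) \<in> gauss_L2 \<beta>"
proof (rule gauss_L2_I)
  show "(\<lambda>s. (f s)\<^sup>2 * gauss_weight \<beta> s + (g s)\<^sup>2 * gauss_weight \<beta> s + 2 * (f s * g s * gauss_weight \<beta> s)) integrable_on {0<..}"
    using f g gauss_L2_mult[OF f g]
    by (intro integrable_add integrable_on_mult_right) (auto simp: gauss_L2_def absolutely_integrable_on_def)
  show "(\<lambda>s. f s + g s) \<in> borel_measurable (lebesgue_on {0<..})"
    by (intro borel_measurable_add gauss_L2_measurable[OF f] gauss_L2_measurable[OF g])
qed (simp add: power2_sum algebra_simps)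

lemma gauss_L2_cmult:
  assumes f: "f \<in> gauss_L2 \<beta>"
  shows "(\<lambda>s. c * f s) \<in> gauss_L2 \<beta>"
proof (rule gauss_L2_I)
  show "(\<lambda>s. c\<^sup>2 * ((f s)\<^sup>2 * gauss_weight \<beta> s)) integrable_on {0<..}"
    using f by (intro integrable_on_mult_right) (auto simp: gauss_L2_def absolutely_integrable_on_def)
  show "(\<lambda>s. c * f s) \<in> borel_measurable (lebesgue_on {0<..})"
    by (intro borel_measurable_times borel_measurable_const gauss_L2_measurable[OF f])
qed (simp add: power_mult_distrib)

lemma gauss_L2_diff:
  assumes "f \<in> gauss_L2 \<beta>" "g \<in> gauss_L2 \<beta>"
  shows "(\<lambda>s. f s - g s) \<in> gauss_L2 \<beta>"
  using gauss_L2_add[OF assms(1) gauss_L2_cmult[OF assms(2), of "-1"]] by simp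

lemma gauss_L2_const: "\<beta> > 0 \<Longrightarrow> (\<lambda>s. c) \<in> gauss_L2 \<beta>"
  using gauss_weight_absolutely_integrable[of \<beta>]
  by (auto simp: gauss_L2_def set_integrable_mult_right)

text \<open>Multiplication by s is isometric from the space with parameter beta + 2 to the one with
  parameter beta. Starting from constants it yields s and s^2, and it turns F / rho = s k into
  \<open>k\<close>.\<close>

lemma gauss_L2_times_id:
  assumes "f \<in> gauss_L2 (\<beta> + 2)"
  shows "(\<lambda>s. s * f s) \<in> gauss_L2 \<beta>"
proof (rule gauss_L2_I)
  show "(\<lambda>s. (f s)\<^sup>2 * gauss_weight (\<beta> + 2) s) integrable_on {0<..}"
    using assms by (simp add: gauss_L2_def absolutely_integrable_on_def)
  show "(\<lambda>s. s * f s) \<in> borel_measurable (lebesgue_on {0<..})"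
    by (intro borel_measurable_times gauss_L2_measurable[OF assms]
        continuous_imp_measurable_on_sets_lebesgue continuous_on_id) auto
qed (auto simp: gauss_weight_add_2 power_mult_distrib)

lemma gauss_L2_id: "\<beta> > 0 \<Longrightarrow> (\<lambda>s. s) \<in> gauss_L2 \<beta>"
  using gauss_L2_times_id[OF gauss_L2_const[of "\<beta> + 2" 1]] by simp

lemma gauss_L2_square: "\<beta> > 0 \<Longrightarrow> (\<lambda>s. s\<^sup>2) \<in> gauss_L2 \<beta>"
  using gauss_L2_times_id[OF gauss_L2_id[of "\<beta> + 2"]] by (simp add: power2_eq_square)

lemma gauss_inner_integrable:
  "f \<in> gauss_L2 \<beta> \<Longrightarrow> g \<in> gauss_L2 \<beta> \<Longrightarrow> (\<lambda>s. f s * g s * gauss_weight \<beta> s) integrable_on {0<..}"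
  using gauss_L2_mult by (auto simp: absolutely_integrable_on_def)

lemma gauss_inner_commute: "gauss_inner \<beta> f g = gauss_inner \<beta> g f"
  by (simp add: gauss_inner_def mult.commute)

lemma gauss_inner_add_left:
  assumes "f \<in> gauss_L2 \<beta>" "g \<in> gauss_L2 \<beta>" "h \<in> gauss_L2 \<beta>"
  shows "gauss_inner \<beta> (\<lambda>s. f s + g s) h = gauss_inner \<beta> f h + gauss_inner \<beta> g h"
  unfolding gauss_inner_def
  using Henstock_Kurzweil_Integration.integral_add[OF gauss_inner_integrable[OF assms(1,3)] gauss_inner_integrable[OF assms(2,3)]]
  by (simp add: algebra_simps)

lemma gauss_inner_cmult_left: "gauss_inner \<beta> (\<lambda>s. c * f s) h = c * gauss_inner \<beta> f h"
  unfolding gauss_inner_def by (simp add: mult.assoc)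

lemma gauss_inner_linear_square:
  assumes "f \<in> gauss_L2 \<beta>" "g \<in> gauss_L2 \<beta>"
  shows "gauss_inner \<beta> (\<lambda>s. f s + c * g s) (\<lambda>s. f s + c * g s) =
    gauss_inner \<beta> f f + 2 * c * gauss_inner \<beta> f g + c\<^sup>2 * gauss_inner \<beta> g g"
proof -
  have h: "(\<lambda>s. f s + c * g s) \<in> gauss_L2 \<beta>" and cg: "(\<lambda>s. c * g s) \<in> gauss_L2 \<beta>"
    using assms by (auto intro: gauss_L2_add gauss_L2_cmult)
  have *: "gauss_inner \<beta> x (\<lambda>s. f s + c * g s) = gauss_inner \<beta> f x + c * gauss_inner \<beta> g x"
    if "x \<in> gauss_L2 \<beta>" for x
    using gauss_inner_add_left[OF assms(1) cg that]
    by (simp add: gauss_inner_cmult_left gauss_inner_commute[of \<beta> x])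
  show ?thesis
    using gauss_inner_add_left[OF assms(1) cg h]
    by (simp add: gauss_inner_cmult_left * assms gauss_inner_commute[of \<beta> g f] power2_eq_square algebra_simps)
qed

lemma gauss_inner_nonneg: "f \<in> gauss_L2 \<beta> \<Longrightarrow> 0 \<le> gauss_inner \<beta> f f"
  unfolding gauss_inner_def
  by (intro integral_nonneg gauss_inner_integrable) (auto simp: gauss_weight_pos less_imp_le)

lemma gauss_inner_times_id:
  "gauss_inner \<beta> (\<lambda>s. s * f s) (\<lambda>s. s * g s) = gauss_inner (\<beta> + 2) f g"
  unfolding gauss_inner_def
  by (intro Henstock_Kurzweil_Integration.integral_cong) (auto simp: gauss_weight_add_2 power2_eq_square)

text \<open>Square integrability of \<open>V\<close> does not make the boundary products converge to
  0. It does give sequences towards 0 and infinity along which s V^2 rho tends to 0, and the bound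
  of \<open>G\<close> squared by s rho is exactly what makes the products vanish there.\<close>

lemma gauss_parts:
  assumes V: "ac_primitive V w" and L2: "V \<in> gauss_L2 \<beta>"
    and G: "\<And>s. s > 0 \<Longrightarrow> (G has_real_derivative g s) (at s)" and g: "continuous_on {0<..} g"
    and wG: "(\<lambda>s. w s * G s) absolutely_integrable_on {0<..}"
    and Vg: "(\<lambda>s. V s * g s) absolutely_integrable_on {0<..}"
    and at_0: "\<forall>\<^sub>F s in at_right 0. (G s)\<^sup>2 \<le> C0 * (s * gauss_weight \<beta> s)"
    and at_inf: "\<forall>\<^sub>F s in at_top. (G s)\<^sup>2 \<le> C1 * (s * gauss_weight \<beta> s)"
  shows "integral {0<..} (\<lambda>s. w s * G s) = - integral {0<..} (\<lambda>s. V s * g s)"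
proof -
  define q where "q s = (V s)\<^sup>2 * gauss_weight \<beta> s" for s
  have q: "q absolutely_integrable_on {0<..}" "\<And>s. s > 0 \<Longrightarrow> 0 \<le> q s"
    using L2 gauss_weight_pos[of _ \<beta>] unfolding q_def by (auto simp: gauss_L2_def less_imp_le)
  obtain a b where a: "\<And>n. a n > 0" "a \<longlonglongrightarrow> 0" "(\<lambda>n. a n * q (a n)) \<longlonglongrightarrow> 0"
    and b: "\<And>n. b n > 0" "filterlim b at_top sequentially" "(\<lambda>n. b n * q (b n)) \<longlonglongrightarrow> 0"
    by (rule integrable_small_along_sequences[OF q]) (assumption, rule that)
  \<comment> \<open>The square of the product is at most \<open>C\<close> times s V^2 rho, which
    tends to 0 along the chosen sequence.\<close>
  have VG: "(\<lambda>n. V (c n) * G (c n)) \<longlonglongrightarrow> 0"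
    if "(\<lambda>n. c n * q (c n)) \<longlonglongrightarrow> 0" "\<forall>\<^sub>F n in sequentially. (G (c n))\<^sup>2 \<le> C * (c n * gauss_weight \<beta> (c n))"
    for c :: "nat \<Rightarrow> real" and C
  proof -
    have "(\<lambda>n. (V (c n) * G (c n))\<^sup>2) \<longlonglongrightarrow> 0"
    proof (rule tendsto_sandwich[OF _ _ tendsto_const])
      show "(\<lambda>n. C * (c n * q (c n))) \<longlonglongrightarrow> 0"
        using tendsto_mult_left[OF that(1), of C] by simp
      show "\<forall>\<^sub>F n in sequentially. (V (c n) * G (c n))\<^sup>2 \<le> C * (c n * q (c n))"
        using that(2)
      proof eventually_elim
        case (elim n)
        then have "(V (c n))\<^sup>2 * (G (c n))\<^sup>2 \<le> (V (c n))\<^sup>2 * (C * (c n * gauss_weight \<beta> (c n)))"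
          by (intro mult_left_mono) auto
        then show ?case by (simp add: q_def power_mult_distrib algebra_simps)
      qed
    qed auto
    then have "(\<lambda>n. sqrt ((V (c n) * G (c n))\<^sup>2)) \<longlonglongrightarrow> sqrt 0"
      by (rule tendsto_real_sqrt)
    then show ?thesis by (simp add: tendsto_rabs_zero_iff)
  qed
  have fa: "filterlim a (at_right 0) sequentially"
    unfolding filterlim_at using a(2) a(1)[THEN less_imp_neq] a(1) by simp
  have VGa: "(\<lambda>n. V (a n) * G (a n)) \<longlonglongrightarrow> 0"
    by (rule VG[OF a(3) eventually_compose_filterlim[OF at_0 fa]])
  have VGb: "(\<lambda>n. V (b n) * G (b n)) \<longlonglongrightarrow> 0"
    by (rule VG[OF b(3) eventually_compose_filterlim[OF at_inf b(2)]])
  let ?f = "\<lambda>s. w s * G s + V s * g s"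
  have f: "?f absolutely_integrable_on {0<..}" using wG Vg by (rule set_integral_add)
  define T where "T x = integral {0<..x} ?f" for x
  note T = integral_initial_segment[OF f, folded T_def]
  have "\<forall>\<^sub>F n in sequentially. a n < 1" "\<forall>\<^sub>F n in sequentially. 1 \<le> b n"
    using order_tendstoD(2)[OF a(2), of 1] b(2) by (auto simp: filterlim_at_top)
  then have "\<forall>\<^sub>F n in sequentially. V (b n) * G (b n) - V (a n) * G (a n) = T (b n) - T (a n)"
  proof eventually_elim
    case (elim n)
    then have ab: "a n \<le> b n" by simp
    have "integral {a n..b n} ?f = V (b n) * G (b n) - V (a n) * G (a n)"
      by (rule ac_primitive_parts[OF V a(1) ab G continuous_on_subset[OF g]])
        (use a(1)[of n] in auto)
    then show ?case using ac_primitiveD(2)[OF T(1) a(1) ab] by simp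
  qed
  moreover have "(\<lambda>n. V (b n) * G (b n) - V (a n) * G (a n)) \<longlonglongrightarrow> 0 - 0"
    by (intro tendsto_diff VGa VGb)
  ultimately have "(\<lambda>n. T (b n) - T (a n)) \<longlonglongrightarrow> 0 - 0"
    by (rule Lim_transform_eventually[rotated])
  \<comment> \<open>The full integral exists, so its value may be computed along these particular
    sequences.\<close>
  moreover have "(\<lambda>n. T (b n) - T (a n)) \<longlonglongrightarrow> integral {0<..} ?f - 0"
    by (intro tendsto_diff filterlim_compose[OF T(3) b(2)] filterlim_compose[OF T(2) fa])
  ultimately have "integral {0<..} ?f = 0" using LIMSEQ_unique by fastforce
  then show ?thesis
    using wG Vg by (subst (asm) Henstock_Kurzweil_Integration.integral_add) (auto simp: absolutely_integrable_on_def)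
qed

lemma integral_Cauchy_Schwarz:
  fixes v \<rho> :: "real \<Rightarrow> real"
  assumes v: "continuous_on {a..b} v" and \<rho>: "continuous_on {a..b} \<rho>" and nn: "\<And>t. t \<in> {a..b} \<Longrightarrow> 0 \<le> \<rho> t"
  shows "(integral {a..b} (\<lambda>t. v t * \<rho> t))\<^sup>2 \<le> integral {a..b} (\<lambda>t. (v t)\<^sup>2 * \<rho> t) * integral {a..b} \<rho>"
proof -
  define A B P where "A = integral {a..b} (\<lambda>t. (v t)\<^sup>2 * \<rho> t)" and "B = integral {a..b} (\<lambda>t. v t * \<rho> t)"
    and "P = integral {a..b} \<rho>"
  have *: "0 \<le> A - 2 * x * B + x\<^sup>2 * P" for x
  proof -
    have i: "(\<lambda>t. (v t)\<^sup>2 * \<rho> t) integrable_on {a..b}" "(\<lambda>t. v t * \<rho> t) integrable_on {a..b}" "\<rho> integrable_on {a..b}"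
      by (intro integrable_continuous_real continuous_intros v \<rho>)+
    have "((\<lambda>t. (v t)\<^sup>2 * \<rho> t - 2 * x * (v t * \<rho> t) + x\<^sup>2 * \<rho> t) has_integral A - 2 * x * B + x\<^sup>2 * P) {a..b}"
      unfolding A_def B_def P_def
      by (intro has_integral_add has_integral_diff has_integral_mult_right integrable_integral i)
    then show ?thesis
    proof (rule has_integral_nonneg)
      fix t assume "t \<in> {a..b}"
      then have "0 \<le> (v t - x)\<^sup>2 * \<rho> t" using nn by simp
      then show "0 \<le> (v t)\<^sup>2 * \<rho> t - 2 * x * (v t * \<rho> t) + x\<^sup>2 * \<rho> t"
        by (simp add: power2_eq_square algebra_simps)
    qed
  qed
  have "P \<ge> 0" unfolding P_def by (intro integral_nonneg integrable_continuous_real \<rho> nn)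
  have "B\<^sup>2 \<le> A * P"
  proof (cases "P = 0")
    case True
    have "B = 0"
    proof (rule ccontr)
      assume "B \<noteq> 0"
      \<comment> \<open>This argument makes \<open>A - 2 * x * B\<close> equal to -1/1, that is,
        negative, while the quadratic coefficient \<open>P\<close> is 0.\<close>
      then show False using *[of "(A + 1) / (2 * B)"] True by (simp add: field_simps)
    qed
    then show ?thesis using True by simp
  next
    case False
    then show ?thesis using *[of "B / P"] \<open>P \<ge> 0\<close>
      by (simp add: field_simps power2_eq_square)
  qed
  then show ?thesis by (simp add: A_def B_def P_def)
qed

lemma gauss_weight_integral:
  assumes "0 < a" "a \<le> b"
  shows "((\<lambda>t. (\<beta> - t\<^sup>2) * gauss_weight \<beta> t) has_integral b * gauss_weight \<beta> b - a * gauss_weight \<beta> a) {a..b}"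
proof (rule fundamental_theorem_of_calculus[OF assms(2)])
  fix t assume "t \<in> {a..b}"
  then have "t > 0" using assms by simp
  from gauss_weight_times_id_derivative[OF this, of \<beta>]
  show "((\<lambda>s. s * gauss_weight \<beta> s) has_vector_derivative (\<beta> - t\<^sup>2) * gauss_weight \<beta> t) (at t within {a..b})"
    by (simp add: has_real_derivative_iff_has_vector_derivative has_vector_derivative_at_within)
qed

lemma gauss_weight_integrable_Icc: "0 < a \<Longrightarrow> gauss_weight \<beta> integrable_on {a..b}"
  by (intro integrable_continuous_real continuous_on_subset[OF gauss_weight_continuous]) auto

text \<open>Below the stated threshold beta - t^2 is at least beta/2, so the weight is dominated by
  a multiple of (s rho)', whose integral is explicit.\<close>

lemma gauss_weight_integral_near_0:
  assumes "\<beta> > 0" "0 < a" "a \<le> s" "s\<^sup>2 \<le> \<beta> / 2"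
  shows "integral {a..s} (gauss_weight \<beta>) \<le> 2 / \<beta> * (s * gauss_weight \<beta> s)"
proof -
  have "((\<lambda>t. \<beta> / 2 * gauss_weight \<beta> t) has_integral \<beta> / 2 * integral {a..s} (gauss_weight \<beta>)) {a..s}"
    by (intro has_integral_mult_right integrable_integral gauss_weight_integrable_Icc assms)
  then have "\<beta> / 2 * integral {a..s} (gauss_weight \<beta>) \<le> s * gauss_weight \<beta> s - a * gauss_weight \<beta> a"
  proof (rule has_integral_le[OF _ gauss_weight_integral])
    fix t assume t: "t \<in> {a..s}"
    then have "t\<^sup>2 \<le> s\<^sup>2" using assms by (intro power_mono) auto
    then have "\<beta> / 2 \<le> \<beta> - t\<^sup>2" using assms(4) by linarith
    then show "\<beta> / 2 * gauss_weight \<beta> t \<le> (\<beta> - t\<^sup>2) * gauss_weight \<beta> t"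
      using t assms gauss_weight_pos[of t \<beta>] by (intro mult_right_mono) simp_all
  qed (use assms in auto)
  moreover have "0 \<le> a * gauss_weight \<beta> a" using assms gauss_weight_pos[of a \<beta>] by simp
  ultimately show ?thesis using assms by (simp add: field_simps)
qed

text \<open>Beyond the threshold t^2 - beta is at least s^2/2, so the weight is dominated by -(s
  rho)' divided by s^2/2. The gain of 1/s^2 over s rho is essential at infinity in
  \<open>dual_identity\<close>.\<close>

lemma gauss_weight_integral_near_infinity:
  assumes "0 < s" "s \<le> b" "2 * \<beta> \<le> s\<^sup>2"
  shows "integral {s..b} (gauss_weight \<beta>) \<le> 2 * gauss_weight \<beta> s / s"
proof -
  have "((\<lambda>t. s\<^sup>2 / 2 * gauss_weight \<beta> t) has_integral s\<^sup>2 / 2 * integral {s..b} (gauss_weight \<beta>)) {s..b}"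
    by (intro has_integral_mult_right integrable_integral gauss_weight_integrable_Icc assms)
  then have "s\<^sup>2 / 2 * integral {s..b} (gauss_weight \<beta>) \<le> - (b * gauss_weight \<beta> b - s * gauss_weight \<beta> s)"
  proof (rule has_integral_le[OF _ has_integral_neg[OF gauss_weight_integral]])
    fix t assume t: "t \<in> {s..b}"
    then have "s\<^sup>2 \<le> t\<^sup>2" using assms by (intro power_mono) auto
    then have "s\<^sup>2 / 2 \<le> t\<^sup>2 - \<beta>" using assms(3) by linarith
    then have "s\<^sup>2 / 2 * gauss_weight \<beta> t \<le> (t\<^sup>2 - \<beta>) * gauss_weight \<beta> t"
      using t assms gauss_weight_pos[of t \<beta>] by (intro mult_right_mono) auto
    then show "s\<^sup>2 / 2 * gauss_weight \<beta> t \<le> - ((\<beta> - t\<^sup>2) * gauss_weight \<beta> t)" by (simp add: algebra_simps)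
  qed (use assms in auto)
  moreover have "0 \<le> b * gauss_weight \<beta> b" using assms gauss_weight_pos[of b \<beta>] by simp
  ultimately have "s\<^sup>2 / 2 * integral {s..b} (gauss_weight \<beta>) \<le> s * gauss_weight \<beta> s" by simp
  then show ?thesis using assms by (simp add: field_simps power2_eq_square)
qed

section \<open>The dual identity\<close>

text \<open>s rho has its maximum at \<open>sqrt \<beta>\<close>, where its derivative (beta - s^2)
  rho changes sign; the maximum is the constant. This is the boundary hypothesis of
  \<open>gauss_parts\<close> for G = s rho.\<close>

lemma gauss_weight_times_id_bounded:
  assumes "\<beta> > 0"
  shows "\<forall>\<^sub>F s in at_right 0. (s * gauss_weight \<beta> s)\<^sup>2 \<le> sqrt \<beta> * gauss_weight \<beta> (sqrt \<beta>) * (s * gauss_weight \<beta> s)"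
    and "\<forall>\<^sub>F s in at_top. (s * gauss_weight \<beta> s)\<^sup>2 \<le> sqrt \<beta> * gauss_weight \<beta> (sqrt \<beta>) * (s * gauss_weight \<beta> s)"
proof -
  define h where "h s = s * gauss_weight \<beta> s" for s
  have sq: "sqrt \<beta> > 0" using assms by simp
  have h: "h s \<le> h (sqrt \<beta>)" if "s > 0" for s
  proof (cases "s \<le> sqrt \<beta>")
    case True
    have "((\<lambda>t. (\<beta> - t\<^sup>2) * gauss_weight \<beta> t) has_integral h (sqrt \<beta>) - h s) {s..sqrt \<beta>}"
      unfolding h_def by (rule gauss_weight_integral[OF that True])
    then have "0 \<le> h (sqrt \<beta>) - h s"
    proof (rule has_integral_nonneg)
      fix t assume t: "t \<in> {s..sqrt \<beta>}"
      then have "t\<^sup>2 \<le> (sqrt \<beta>)\<^sup>2" using that by (intro power_mono) auto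
      then have "0 \<le> \<beta> - t\<^sup>2" using assms by simp
      then show "0 \<le> (\<beta> - t\<^sup>2) * gauss_weight \<beta> t"
        using gauss_weight_pos[of t \<beta>] t that by (intro mult_nonneg_nonneg) auto
    qed
    then show ?thesis by simp
  next
    case False
    have "((\<lambda>t. - ((\<beta> - t\<^sup>2) * gauss_weight \<beta> t)) has_integral - (h s - h (sqrt \<beta>))) {sqrt \<beta>..s}"
      unfolding h_def by (rule has_integral_neg[OF gauss_weight_integral]) (use False sq in auto)
    then have "0 \<le> - (h s - h (sqrt \<beta>))"
    proof (rule has_integral_nonneg)
      fix t assume t: "t \<in> {sqrt \<beta>..s}"
      then have "(sqrt \<beta>)\<^sup>2 \<le> t\<^sup>2" using sq by (intro power_mono) auto
      then have "\<beta> - t\<^sup>2 \<le> 0" using assms by simp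
      moreover have "t > 0" using less_le_trans[OF sq] t by simp
      ultimately show "0 \<le> - ((\<beta> - t\<^sup>2) * gauss_weight \<beta> t)"
        using gauss_weight_pos[of t \<beta>] by (simp add: mult_le_0_iff)
    qed
    then show ?thesis by simp
  qed
  have "(h s)\<^sup>2 \<le> h (sqrt \<beta>) * h s" if "s > 0" for s
    using h[OF that] gauss_weight_pos[OF that, of \<beta>] that
    by (simp add: power2_eq_square mult_right_mono h_def)
  then show "\<forall>\<^sub>F s in at_right 0. (s * gauss_weight \<beta> s)\<^sup>2 \<le> sqrt \<beta> * gauss_weight \<beta> (sqrt \<beta>) * (s * gauss_weight \<beta> s)"
    "\<forall>\<^sub>F s in at_top. (s * gauss_weight \<beta> s)\<^sup>2 \<le> sqrt \<beta> * gauss_weight \<beta> (sqrt \<beta>) * (s * gauss_weight \<beta> s)"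
    unfolding h_def by (auto simp: eventually_at_filter intro: eventually_mono[OF eventually_gt_at_top[of 0]])
qed

text \<open>Integration by parts against s rho. It transfers orthogonality to 1 and s^2 from a
  function to orthogonality to s of its derivative, and it computes the moments.\<close>

lemma gauss_inner_derivative_id:
  assumes "\<beta> > 0" and V: "ac_primitive V w" and L2: "V \<in> gauss_L2 \<beta>" "w \<in> gauss_L2 \<beta>"
  shows "gauss_inner \<beta> w (\<lambda>s. s) = gauss_inner \<beta> V (\<lambda>s. s\<^sup>2) - \<beta> * gauss_inner \<beta> V (\<lambda>s. 1)"
proof -
  have one: "(\<lambda>s. 1) \<in> gauss_L2 \<beta>" by (intro gauss_L2_const assms)
  have c: "(\<lambda>s. \<beta> - s\<^sup>2) \<in> gauss_L2 \<beta>"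
    by (intro gauss_L2_diff gauss_L2_const gauss_L2_square assms)
  have "integral {0<..} (\<lambda>s. w s * (s * gauss_weight \<beta> s)) = - integral {0<..} (\<lambda>s. V s * ((\<beta> - s\<^sup>2) * gauss_weight \<beta> s))"
  proof (rule gauss_parts[OF V L2(1) _ _ _ _ gauss_weight_times_id_bounded[OF assms(1)]])
    show "((\<lambda>s. s * gauss_weight \<beta> s) has_real_derivative (\<beta> - s\<^sup>2) * gauss_weight \<beta> s) (at s)" if "s > 0" for s
      by (rule gauss_weight_times_id_derivative[OF that])
    show "continuous_on {0<..} (\<lambda>s. (\<beta> - s\<^sup>2) * gauss_weight \<beta> s)"
      by (intro continuous_intros gauss_weight_continuous)
    show "(\<lambda>s. w s * (s * gauss_weight \<beta> s)) absolutely_integrable_on {0<..}"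
      using gauss_L2_mult[OF L2(2) gauss_L2_id[OF assms(1)]] by (simp add: mult.assoc)
    show "(\<lambda>s. V s * ((\<beta> - s\<^sup>2) * gauss_weight \<beta> s)) absolutely_integrable_on {0<..}"
      using gauss_L2_mult[OF L2(1) c] by (simp add: mult.assoc)
  qed
  moreover have "gauss_inner \<beta> V (\<lambda>s. s\<^sup>2) + gauss_inner \<beta> V (\<lambda>s. \<beta> - s\<^sup>2) = \<beta> * gauss_inner \<beta> V (\<lambda>s. 1)"
    using gauss_inner_add_left[OF gauss_L2_square[OF assms(1)] c L2(1)] gauss_inner_cmult_left[of \<beta> \<beta> "\<lambda>s. 1" V]
    by (simp add: gauss_inner_commute[of \<beta> V])
  ultimately show ?thesis by (simp add: gauss_inner_def mult.assoc)
qed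

text \<open>With \<open>T\<close> the running integral of v^2 rho and B = k^2 (beta - s^2) s rho,
  the derivative of T - B is (s k')^2 rho + 2 (s k)^2 rho. This is nonnegative, so integrability and
  the identity follow together once B vanishes at both ends. The constants \<open>C0\<close> and
  \<open>C1\<close> are passed on for later integrations by parts against \<open>F\<close>.\<close>

lemma dual_identity:
  fixes v F :: "real \<Rightarrow> real"
  assumes "\<beta> > 0" and v: "continuous_on {0<..} v" and L2: "v \<in> gauss_L2 \<beta>"
    and F: "\<And>s. s > 0 \<Longrightarrow> (F has_real_derivative v s * gauss_weight \<beta> s) (at s)"
    and F0: "(F \<longlongrightarrow> 0) (at_right 0)" and Finf: "(F \<longlongrightarrow> 0) at_top"
  defines "k \<equiv> \<lambda>s. F s / (s * gauss_weight \<beta> s)"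
  defines "k' \<equiv> \<lambda>s. (v s - (\<beta> - s\<^sup>2) * k s) / s"
  obtains C0 C1 where
    "\<forall>\<^sub>F s in at_right 0. (F s)\<^sup>2 \<le> C0 * (s * gauss_weight \<beta> s)"
    "\<forall>\<^sub>F s in at_top. (F s)\<^sup>2 \<le> C1 * (s * gauss_weight \<beta> s)"
    "\<And>s. s > 0 \<Longrightarrow> (k has_real_derivative k' s) (at s)" "continuous_on {0<..} k'"
    "k \<in> gauss_L2 (\<beta> + 2)" "k' \<in> gauss_L2 (\<beta> + 2)"
    "gauss_inner \<beta> v v = gauss_inner (\<beta> + 2) k' k' + 2 * gauss_inner (\<beta> + 2) k k"
proof -
  let ?\<rho> = "gauss_weight \<beta>"
  define q where "q s = (v s)\<^sup>2 * ?\<rho> s" for s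
  define T where "T x = integral {0<..x} q" for x
  define I where "I = integral {0<..} q"
  have q: "q absolutely_integrable_on {0<..}" using L2 unfolding q_def by (simp add: gauss_L2_def)
  have cq: "continuous_on {0<..} q"
    unfolding q_def by (intro continuous_intros v gauss_weight_continuous)
  note T = integral_initial_segment[OF q, folded T_def I_def]
  note dT = ac_primitive_has_real_derivative[OF T(1) cq]
  have q0: "0 \<le> q s" if "s > 0" for s using gauss_weight_pos[OF that, of \<beta>] by (simp add: q_def)
  have qi: "q integrable_on S" if "S \<subseteq> {0<..}" "S \<in> sets lebesgue" for S
    using set_integrable_subset[OF q _ that(1)] that(2) by (auto simp: absolutely_integrable_on_def)
  have T0: "0 \<le> T s" and TI: "T s \<le> I" for s
  proof -
    show "0 \<le> T s" unfolding T_def by (intro integral_nonneg qi) (auto intro: q0)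
    show "T s \<le> I" unfolding T_def I_def by (intro integral_subset_le qi) (auto intro: q0)
  qed
  have ac: "ac_primitive F (\<lambda>s. v s * ?\<rho> s)"
    by (rule ac_primitive_of_derivative[OF F]) (assumption, intro continuous_intros v gauss_weight_continuous)
  \<comment> \<open>Cauchy-Schwarz with respect to the weight: an increment of \<open>F\<close> is
    controlled by energy times mass of the interval.\<close>
  have CS: "(F b - F a)\<^sup>2 \<le> (T b - T a) * integral {a..b} ?\<rho>" if "0 < a" "a \<le> b" for a b
  proof -
    have "continuous_on {a..b} v" "continuous_on {a..b} ?\<rho>"
      using that by (auto intro!: continuous_on_subset[OF v] continuous_on_subset[OF gauss_weight_continuous])
    then have "(integral {a..b} (\<lambda>t. v t * ?\<rho> t))\<^sup>2 \<le> integral {a..b} q * integral {a..b} ?\<rho>"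
      unfolding q_def by (intro integral_Cauchy_Schwarz gauss_weight_nonneg)
    then show ?thesis
      using ac_primitiveD(2)[OF ac that] ac_primitiveD(2)[OF T(1) that] by simp
  qed
  \<comment> \<open>Let the left end go to 0, where \<open>F\<close> vanishes. The factor
    \<open>T s\<close> is retained because it tends to 0 and makes the boundary term vanish.\<close>
  have bound0: "(F s)\<^sup>2 \<le> T s * (2 / \<beta> * (s * ?\<rho> s))" if "0 < s" "s\<^sup>2 \<le> \<beta> / 2" for s
  proof (rule tendsto_upperbound)
    show "((\<lambda>a. (F s - F a)\<^sup>2) \<longlongrightarrow> (F s)\<^sup>2) (at_right 0)"
      using tendsto_power[OF tendsto_diff[OF tendsto_const F0], of "F s" 2] by simp
    have "(F s - F a)\<^sup>2 \<le> T s * (2 / \<beta> * (s * ?\<rho> s))" if a: "0 < a" "a < s" for a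
    proof -
      have "(F s - F a)\<^sup>2 \<le> (T s - T a) * integral {a..s} ?\<rho>" using CS a by simp
      also have "\<dots> \<le> T s * (2 / \<beta> * (s * ?\<rho> s))"
      proof (rule mult_mono)
        show "integral {a..s} ?\<rho> \<le> 2 / \<beta> * (s * ?\<rho> s)"
          by (rule gauss_weight_integral_near_0) (use assms(1) a \<open>s\<^sup>2 \<le> \<beta> / 2\<close> in auto)
        show "0 \<le> integral {a..s} ?\<rho>"
          using a by (intro integral_nonneg gauss_weight_integrable_Icc gauss_weight_nonneg)
      qed (use T0 in auto)
      finally show ?thesis .
    qed
    then show "\<forall>\<^sub>F a in at_right 0. (F s - F a)\<^sup>2 \<le> T s * (2 / \<beta> * (s * ?\<rho> s))"
      using \<open>0 < s\<close> by (auto simp: eventually_at_right intro!: exI[of _ s])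
  qed simp
  \<comment> \<open>The mirror image, with the remaining energy \<open>I - T s\<close>. The factor
    rho/s, rather than s rho, compensates the s^2 contained in \<open>B\<close>.\<close>
  have boundinf: "(F s)\<^sup>2 \<le> (I - T s) * (2 * ?\<rho> s / s)" if "0 < s" "2 * \<beta> \<le> s\<^sup>2" for s
  proof (rule tendsto_upperbound)
    show "((\<lambda>b. (F b - F s)\<^sup>2) \<longlongrightarrow> (F s)\<^sup>2) at_top"
      using tendsto_power[OF tendsto_diff[OF Finf tendsto_const], of "F s" 2] by simp
    have "(F b - F s)\<^sup>2 \<le> (I - T s) * (2 * ?\<rho> s / s)" if b: "s \<le> b" for b
    proof -
      have "(F b - F s)\<^sup>2 \<le> (T b - T s) * integral {s..b} ?\<rho>" using CS b \<open>0 < s\<close> by simp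
      also have "\<dots> \<le> (I - T s) * (2 * ?\<rho> s / s)"
      proof (rule mult_mono)
        show "integral {s..b} ?\<rho> \<le> 2 * ?\<rho> s / s"
          by (rule gauss_weight_integral_near_infinity) (use b that \<open>0 < s\<close> \<open>2 * \<beta> \<le> s\<^sup>2\<close> in auto)
        show "0 \<le> integral {s..b} ?\<rho>"
          using \<open>0 < s\<close> by (intro integral_nonneg gauss_weight_integrable_Icc gauss_weight_nonneg)
      qed (use TI in auto)
      finally show ?thesis .
    qed
    then show "\<forall>\<^sub>F b in at_top. (F b - F s)\<^sup>2 \<le> (I - T s) * (2 * ?\<rho> s / s)"
      by (auto simp: eventually_at_top_linorder)
  qed simp
  have ev0: "\<forall>\<^sub>F s in at_right 0. 0 < s \<and> s\<^sup>2 \<le> \<beta> / 2"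
  proof -
    have "((\<lambda>s::real. s\<^sup>2) \<longlongrightarrow> 0\<^sup>2) (at_right 0)" by (intro tendsto_intros)
    then have "\<forall>\<^sub>F s::real in at_right 0. s\<^sup>2 < \<beta> / 2"
      by (rule order_tendstoD(2)) (use assms(1) in simp)
    moreover have "\<forall>\<^sub>F s::real in at_right 0. 0 < s" by (simp add: eventually_at_right_less)
    ultimately show ?thesis by eventually_elim auto
  qed
  have evinf: "\<forall>\<^sub>F s in at_top. 1 \<le> s \<and> 2 * \<beta> \<le> s\<^sup>2"
  proof -
    have "1 \<le> s \<and> 2 * \<beta> \<le> s\<^sup>2" if "max 1 (2 * \<beta>) \<le> s" for s
    proof -
      have "1 * s \<le> s * s" using that by (intro mult_right_mono) auto
      moreover have "2 * \<beta> \<le> s" "1 \<le> s" using that by auto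
      ultimately show ?thesis unfolding power2_eq_square by linarith
    qed
    then show ?thesis unfolding eventually_at_top_linorder by blast
  qed
  have C0: "\<forall>\<^sub>F s in at_right 0. (F s)\<^sup>2 \<le> I * (2 / \<beta>) * (s * ?\<rho> s)"
    using ev0
  proof eventually_elim
    case (elim s)
    have "T s * (2 / \<beta> * (s * ?\<rho> s)) \<le> I * (2 / \<beta> * (s * ?\<rho> s))"
      using elim TI assms(1) gauss_weight_pos[of s \<beta>] by (intro mult_right_mono) auto
    then show ?case using bound0[of s] elim by (simp add: mult.assoc)
  qed
  have C1: "\<forall>\<^sub>F s in at_top. (F s)\<^sup>2 \<le> I * 2 * (s * ?\<rho> s)"
    using evinf
  proof eventually_elim
    case (elim s)
    then have "s > 0" by simp
    have "1 * 1 \<le> s * s" using elim by (intro mult_mono) auto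
    then have "?\<rho> s / s \<le> s * ?\<rho> s"
      using \<open>s > 0\<close> gauss_weight_pos[OF \<open>s > 0\<close>, of \<beta>] by (simp add: field_simps)
    then have "(I - T s) * (2 * ?\<rho> s / s) \<le> I * (2 * (s * ?\<rho> s))"
      using T0[of s] TI[of s] \<open>s > 0\<close> gauss_weight_pos[OF \<open>s > 0\<close>, of \<beta>] by (intro mult_mono) auto
    then show ?case using boundinf[of s] elim \<open>s > 0\<close> by (simp add: mult.assoc)
  qed
  \<comment> \<open>In terms of \<open>k\<close> this is k^2 (beta - s^2) s rho, the primitive of
    the mixed term in the expanded square together with its correction.\<close>
  define B where "B s = (F s)\<^sup>2 * (\<beta> - s\<^sup>2) / (s * ?\<rho> s)" for s
  have B0: "(B \<longlongrightarrow> 0) (at_right 0)"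
  proof (rule Lim_null_comparison)
    show "((\<lambda>s. 2 * T s) \<longlongrightarrow> 0) (at_right 0)" using tendsto_mult_left[OF T(2), of 2] by simp
    show "\<forall>\<^sub>F s in at_right 0. norm (B s) \<le> 2 * T s"
      using ev0
    proof eventually_elim
      case (elim s)
      then have \<rho>: "0 < s * ?\<rho> s" using gauss_weight_pos[of s \<beta>] by simp
      \<comment> \<open>The bound by \<open>\<beta>\<close> cancels the 1/beta of the mass estimate,
        leaving twice the energy near 0.\<close>
      have "0 \<le> \<beta> - s\<^sup>2" "\<beta> - s\<^sup>2 \<le> \<beta>" using elim assms(1) by auto
      then have "(F s)\<^sup>2 * (\<beta> - s\<^sup>2) \<le> T s * (2 / \<beta> * (s * ?\<rho> s)) * \<beta>"
        using bound0[of s] elim T0[of s] assms(1) \<rho> by (intro mult_mono) auto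
      also have "\<dots> = 2 * T s * (s * ?\<rho> s)" using assms(1) by (simp add: field_simps)
      finally have "(F s)\<^sup>2 * (\<beta> - s\<^sup>2) / (s * ?\<rho> s) \<le> 2 * T s"
        using \<rho> by (simp only: pos_divide_le_eq)
      moreover have "0 \<le> (F s)\<^sup>2 * (\<beta> - s\<^sup>2) / (s * ?\<rho> s)"
        using \<open>0 \<le> \<beta> - s\<^sup>2\<close> \<rho> by (intro divide_nonneg_pos mult_nonneg_nonneg) auto
      ultimately show ?case by (simp add: B_def)
    qed
  qed
  have Binf: "(B \<longlongrightarrow> 0) at_top"
  proof (rule Lim_null_comparison)
    show "((\<lambda>s. 2 * (I - T s)) \<longlongrightarrow> 0) at_top"
      using tendsto_mult_left[OF tendsto_diff[OF tendsto_const T(3)], of 2 I] by simp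
    show "\<forall>\<^sub>F s in at_top. norm (B s) \<le> 2 * (I - T s)"
      using evinf
    proof eventually_elim
      case (elim s)
      then have s: "s > 0" by simp
      then have \<rho>: "0 < s * ?\<rho> s" using gauss_weight_pos[of s \<beta>] by simp
      have "0 \<le> s\<^sup>2 - \<beta>" "s\<^sup>2 - \<beta> \<le> s\<^sup>2" using elim assms(1) by auto
      then have "(F s)\<^sup>2 * (s\<^sup>2 - \<beta>) \<le> (I - T s) * (2 * ?\<rho> s / s) * s\<^sup>2"
        using boundinf[of s] elim TI[of s] s gauss_weight_pos[OF s, of \<beta>] by (intro mult_mono) auto
      also have "\<dots> = 2 * (I - T s) * (s * ?\<rho> s)" using s by (simp add: field_simps power2_eq_square)
      finally have "(F s)\<^sup>2 * (s\<^sup>2 - \<beta>) / (s * ?\<rho> s) \<le> 2 * (I - T s)"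
        using \<rho> by (simp only: pos_divide_le_eq)
      moreover have "0 \<le> (F s)\<^sup>2 * (s\<^sup>2 - \<beta>) / (s * ?\<rho> s)"
        using \<open>0 \<le> s\<^sup>2 - \<beta>\<close> \<rho> by (intro divide_nonneg_pos mult_nonneg_nonneg) auto
      moreover have "B s = - ((F s)\<^sup>2 * (s\<^sup>2 - \<beta>) / (s * ?\<rho> s))"
        by (simp add: B_def minus_divide_left flip: mult_minus_right)
      ultimately show ?case by simp
    qed
  qed
  have Fk: "F s = k s * (s * ?\<rho> s)" if "s > 0" for s
    using gauss_weight_pos[OF that, of \<beta>] that by (simp add: k_def)
  have dk: "(k has_real_derivative k' s) (at s)" if s: "s > 0" for s
  proof -
    have "s * ?\<rho> s \<noteq> 0" using gauss_weight_pos[OF s, of \<beta>] s by simp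
    from DERIV_divide[OF F[OF s] gauss_weight_times_id_derivative[OF s] this]
    show ?thesis unfolding k_def
      by (rule DERIV_cong)
        (use gauss_weight_pos[OF s, of \<beta>] s Fk[OF s] in \<open>simp add: k'_def field_simps\<close>)
  qed
  have ck: "continuous_on {0<..} k"
    using dk by (intro continuous_at_imp_continuous_on) (auto intro: DERIV_isCont)
  have ck': "continuous_on {0<..} k'"
    unfolding k'_def by (intro continuous_intros v ck) auto
  have dB: "(B has_real_derivative
      (2 * (v s * k s * (\<beta> - s\<^sup>2)) - (k s)\<^sup>2 * (2 * s\<^sup>2 + (\<beta> - s\<^sup>2)\<^sup>2)) * ?\<rho> s) (at s)" if s: "s > 0" for s
  proof -
    have "((\<lambda>s. (k s)\<^sup>2 * ((\<beta> - s\<^sup>2) * (s * ?\<rho> s))) has_real_derivative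
        (2 * (v s * k s * (\<beta> - s\<^sup>2)) - (k s)\<^sup>2 * (2 * s\<^sup>2 + (\<beta> - s\<^sup>2)\<^sup>2)) * ?\<rho> s) (at s)"
    proof -
      have vs: "v s = s * k' s + (\<beta> - s\<^sup>2) * k s" using s by (simp add: k'_def)
      have "((\<lambda>s. \<beta> - s\<^sup>2) has_real_derivative - 2 * s) (at s)"
        by (auto intro!: derivative_eq_intros)
      from DERIV_mult[OF DERIV_power[OF dk[OF s], of 2] DERIV_mult[OF this gauss_weight_times_id_derivative[OF s, of \<beta>]]]
      show ?thesis unfolding vs
        by (rule DERIV_cong) (simp, simp add: algebra_simps power2_eq_square)
    qed
    then show ?thesis
    proof (rule has_field_derivative_transform_within_open[of _ _ _ "{0<..}"])
      fix t :: real assume "t \<in> {0<..}"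
      then show "(k t)\<^sup>2 * ((\<beta> - t\<^sup>2) * (t * ?\<rho> t)) = B t"
        using gauss_weight_pos[of t \<beta>] Fk[of t] by (simp add: B_def power_mult_distrib power2_eq_square)
    qed (use s in auto)
  qed
  let ?f = "\<lambda>s. ((s * k' s)\<^sup>2 + 2 * (s * k s)\<^sup>2) * ?\<rho> s"
  have dG: "((\<lambda>s. T s - B s) has_real_derivative ?f s) (at s)" if s: "s > 0" for s
  proof -
    have "s * k' s = v s - (\<beta> - s\<^sup>2) * k s" using s by (simp add: k'_def)
    then show ?thesis
      by (intro DERIV_cong[OF DERIV_diff[OF dT[OF s] dB[OF s]]])
        (simp add: q_def, simp add: algebra_simps power2_eq_square)
  qed
  have cf: "continuous_on {0<..} ?f"
    by (intro continuous_intros ck ck' gauss_weight_continuous)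
  have f0: "0 \<le> ?f s" if "s > 0" for s using gauss_weight_pos[OF that, of \<beta>] by simp
  note ftc = improper_FTC_nonneg[OF dG cf f0 tendsto_diff[OF T(2) B0] tendsto_diff[OF T(3) Binf]]
  have fi: "?f integrable_on {0<..}" using ftc(1) by (simp add: absolutely_integrable_on_def)
  have m: "k \<in> borel_measurable (lebesgue_on {0<..})" "k' \<in> borel_measurable (lebesgue_on {0<..})"
    by (intro continuous_imp_measurable_on_sets_lebesgue ck ck'; simp)+
  have kL2: "k \<in> gauss_L2 (\<beta> + 2)"
  proof (rule gauss_L2_I[OF m(1) fi])
    fix s :: real assume s: "s > 0"
    have "(s * k s)\<^sup>2 * ?\<rho> s \<le> ?f s"
      using gauss_weight_pos[OF s, of \<beta>] by (intro mult_right_mono) auto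
    then show "(k s)\<^sup>2 * gauss_weight (\<beta> + 2) s \<le> ?f s"
      using s by (simp add: gauss_weight_add_2 power_mult_distrib mult_ac)
  qed
  have k'L2: "k' \<in> gauss_L2 (\<beta> + 2)"
  proof (rule gauss_L2_I[OF m(2) fi])
    fix s :: real assume s: "s > 0"
    have "(s * k' s)\<^sup>2 * ?\<rho> s \<le> ?f s"
      using gauss_weight_pos[OF s, of \<beta>] by (intro mult_right_mono) auto
    then show "(k' s)\<^sup>2 * gauss_weight (\<beta> + 2) s \<le> ?f s"
      using s by (simp add: gauss_weight_add_2 power_mult_distrib mult_ac)
  qed
  have "gauss_inner \<beta> v v = I" by (simp add: gauss_inner_def I_def q_def[abs_def] power2_eq_square)
  also have "\<dots> = integral {0<..} ?f" using ftc(2) by simp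
  also have "\<dots> = integral {0<..} (\<lambda>s. k' s * k' s * gauss_weight (\<beta> + 2) s + 2 * (k s * k s * gauss_weight (\<beta> + 2) s))"
    by (intro Henstock_Kurzweil_Integration.integral_cong)
      (auto simp: gauss_weight_add_2 power2_eq_square algebra_simps)
  also have "\<dots> = gauss_inner (\<beta> + 2) k' k' + 2 * gauss_inner (\<beta> + 2) k k"
    unfolding gauss_inner_def using gauss_inner_integrable[OF kL2 kL2] gauss_inner_integrable[OF k'L2 k'L2]
    by (subst Henstock_Kurzweil_Integration.integral_add) (auto intro: integrable_on_mult_right)
  finally show ?thesis
    by (intro that[OF C0 C1 dk ck' kL2 k'L2])
qed

section \<open>Spectral gaps\<close>

text \<open>Here F / rho is \<open>s * k\<close>, so the integral of F^2 / rho is the squared norm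
  of \<open>k\<close> for parameter beta + 2. The gap \<open>l\<close> is kept general, as the step
  serves for 2 and for 4.\<close>

lemma gauss_energy_of_dual:
  fixes V w F :: "real \<Rightarrow> real"
  assumes V: "ac_primitive V w" and L2: "V \<in> gauss_L2 \<beta>" "w \<in> gauss_L2 \<beta>"
    and F: "\<And>s. s > 0 \<Longrightarrow> (F has_real_derivative V s * gauss_weight \<beta> s) (at s)"
    and C0: "\<forall>\<^sub>F s in at_right 0. (F s)\<^sup>2 \<le> C0 * (s * gauss_weight \<beta> s)"
    and C1: "\<forall>\<^sub>F s in at_top. (F s)\<^sup>2 \<le> C1 * (s * gauss_weight \<beta> s)"
  defines "k \<equiv> \<lambda>s. F s / (s * gauss_weight \<beta> s)"
  assumes k: "k \<in> gauss_L2 (\<beta> + 2)"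
    and dual: "l * gauss_inner (\<beta> + 2) k k \<le> gauss_inner \<beta> V V" and "l \<ge> 0"
  shows "l * gauss_inner \<beta> V V \<le> gauss_inner \<beta> w w"
proof -
  have sk: "(\<lambda>s. s * k s) \<in> gauss_L2 \<beta>" by (rule gauss_L2_times_id[OF k])
  have Fk: "F s = s * k s * gauss_weight \<beta> s" if "s > 0" for s
    using gauss_weight_pos[OF that, of \<beta>] that by (simp add: k_def)
  have eq: "w s * F s = w s * (s * k s) * gauss_weight \<beta> s" if "s \<in> {0<..}" for s
    using Fk[of s] that by simp
  have wF: "(\<lambda>s. w s * F s) absolutely_integrable_on {0<..}"
    by (rule absolutely_integrable_spike[OF gauss_L2_mult[OF L2(2) sk], of "{}"]) (use eq in auto)
  have "integral {0<..} (\<lambda>s. w s * F s) = - integral {0<..} (\<lambda>s. V s * (V s * gauss_weight \<beta> s))"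
  proof (rule gauss_parts[OF V L2(1) F _ wF _ C0 C1])
    show "continuous_on {0<..} (\<lambda>s. V s * gauss_weight \<beta> s)"
      by (intro continuous_intros ac_primitive_continuous[OF V] gauss_weight_continuous)
    show "(\<lambda>s. V s * (V s * gauss_weight \<beta> s)) absolutely_integrable_on {0<..}"
      using gauss_L2_mult[OF L2(1) L2(1)] by (simp add: mult.assoc)
  qed
  moreover have "integral {0<..} (\<lambda>s. w s * F s) = gauss_inner \<beta> w (\<lambda>s. s * k s)"
    unfolding gauss_inner_def by (rule Henstock_Kurzweil_Integration.integral_cong[OF eq])
  ultimately have cross: "gauss_inner \<beta> w (\<lambda>s. s * k s) = - gauss_inner \<beta> V V"
    by (simp add: gauss_inner_def mult.assoc)
  have "0 \<le> gauss_inner \<beta> (\<lambda>s. w s + l * (s * k s)) (\<lambda>s. w s + l * (s * k s))"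
    by (intro gauss_inner_nonneg gauss_L2_add gauss_L2_cmult L2 sk)
  also have "\<dots> = gauss_inner \<beta> w w - 2 * l * gauss_inner \<beta> V V + l\<^sup>2 * gauss_inner (\<beta> + 2) k k"
    by (simp only: gauss_inner_linear_square[OF L2(2) sk] cross gauss_inner_times_id)
  also have "\<dots> \<le> gauss_inner \<beta> w w - 2 * l * gauss_inner \<beta> V V + l * gauss_inner \<beta> V V"
    using mult_left_mono[OF dual \<open>l \<ge> 0\<close>] by (simp add: power2_eq_square mult.assoc)
  finally show ?thesis by simp
qed

text \<open>The initial integral of v rho tends to the full integral at infinity, so mean zero is
  what makes it vanish there.\<close>

lemma gauss_mean_zero_antiderivative:
  assumes "\<beta> > 0" and v: "continuous_on {0<..} v" and L2: "v \<in> gauss_L2 \<beta>"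
    and mean: "gauss_inner \<beta> v (\<lambda>s. 1) = 0"
  obtains F where "\<And>s. s > 0 \<Longrightarrow> (F has_real_derivative v s * gauss_weight \<beta> s) (at s)"
    "(F \<longlongrightarrow> 0) (at_right 0)" "(F \<longlongrightarrow> 0) at_top"
proof -
  have f: "(\<lambda>s. v s * gauss_weight \<beta> s) absolutely_integrable_on {0<..}"
    using gauss_L2_mult[OF L2 gauss_L2_const[OF assms(1)], of 1] by simp
  have c: "continuous_on {0<..} (\<lambda>s. v s * gauss_weight \<beta> s)"
    by (intro continuous_intros v gauss_weight_continuous)
  note I = integral_initial_segment[OF f]
  show ?thesis
    using that[OF ac_primitive_has_real_derivative[OF I(1) c] I(2)] I(3) mean
    by (simp add: gauss_inner_def)
qed

text \<open>Stated for a general parameter because \<open>gauss_Poincare_orthogonal\<close> applies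
  it to \<open>k\<close> with parameter alpha + 2.\<close>

lemma gauss_Poincare:
  assumes "\<beta> > 0" and V: "ac_primitive V w" and L2: "V \<in> gauss_L2 \<beta>" "w \<in> gauss_L2 \<beta>"
    and mean: "gauss_inner \<beta> V (\<lambda>s. 1) = 0"
  shows "2 * gauss_inner \<beta> V V \<le> gauss_inner \<beta> w w"
proof -
  note c = ac_primitive_continuous[OF V]
  obtain F where F: "\<And>s. s > 0 \<Longrightarrow> (F has_real_derivative V s * gauss_weight \<beta> s) (at s)"
    "(F \<longlongrightarrow> 0) (at_right 0)" "(F \<longlongrightarrow> 0) at_top"
    by (rule gauss_mean_zero_antiderivative[OF assms(1) c L2(1) mean]) (rule that)
  show ?thesis
  proof (rule dual_identity[OF assms(1) c L2(1) F], assumption)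
    fix C0 C1
    let ?k = "\<lambda>s. F s / (s * gauss_weight \<beta> s)"
    let ?k' = "\<lambda>s. (V s - (\<beta> - s\<^sup>2) * ?k s) / s"
    assume C: "\<forall>\<^sub>F s in at_right 0. (F s)\<^sup>2 \<le> C0 * (s * gauss_weight \<beta> s)"
      "\<forall>\<^sub>F s in at_top. (F s)\<^sup>2 \<le> C1 * (s * gauss_weight \<beta> s)"
      and k: "?k \<in> gauss_L2 (\<beta> + 2)" "?k' \<in> gauss_L2 (\<beta> + 2)"
      and eq: "gauss_inner \<beta> V V = gauss_inner (\<beta> + 2) ?k' ?k' + 2 * gauss_inner (\<beta> + 2) ?k ?k"
    show ?thesis
      by (rule gauss_energy_of_dual[OF V L2 F(1) C k(1)]) (use eq gauss_inner_nonneg[OF k(2)] in auto)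
  qed
qed

lemma gauss_Poincare_orthogonal:
  assumes "\<alpha> > 0" and V: "ac_primitive V w" and L2: "V \<in> gauss_L2 \<alpha>" "w \<in> gauss_L2 \<alpha>"
    and mean: "gauss_inner \<alpha> V (\<lambda>s. 1) = 0" and orth: "gauss_inner \<alpha> V (\<lambda>s. s\<^sup>2) = 0"
  shows "4 * gauss_inner \<alpha> V V \<le> gauss_inner \<alpha> w w"
proof -
  note c = ac_primitive_continuous[OF V]
  obtain F where F: "\<And>s. s > 0 \<Longrightarrow> (F has_real_derivative V s * gauss_weight \<alpha> s) (at s)"
    "(F \<longlongrightarrow> 0) (at_right 0)" "(F \<longlongrightarrow> 0) at_top"
    by (rule gauss_mean_zero_antiderivative[OF assms(1) c L2(1) mean]) (rule that)
  show ?thesis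
  proof (rule dual_identity[OF assms(1) c L2(1) F], assumption)
    fix C0 C1
    let ?k = "\<lambda>s. F s / (s * gauss_weight \<alpha> s)"
    let ?k' = "\<lambda>s. (V s - (\<alpha> - s\<^sup>2) * ?k s) / s"
    assume C: "\<forall>\<^sub>F s in at_right 0. (F s)\<^sup>2 \<le> C0 * (s * gauss_weight \<alpha> s)"
      "\<forall>\<^sub>F s in at_top. (F s)\<^sup>2 \<le> C1 * (s * gauss_weight \<alpha> s)"
      and dk: "\<And>s. s > 0 \<Longrightarrow> (?k has_real_derivative ?k' s) (at s)" and ck': "continuous_on {0<..} ?k'"
      and k: "?k \<in> gauss_L2 (\<alpha> + 2)" "?k' \<in> gauss_L2 (\<alpha> + 2)"
      and eq: "gauss_inner \<alpha> V V = gauss_inner (\<alpha> + 2) ?k' ?k' + 2 * gauss_inner (\<alpha> + 2) ?k ?k"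
    have ac: "ac_primitive ?k ?k'" by (rule ac_primitive_of_derivative[OF dk ck'])
    have sF: "s * F s = ?k s * 1 * gauss_weight (\<alpha> + 2) s" if "s \<in> {0<..}" for s
      using that gauss_weight_pos[of s \<alpha>] by (simp add: gauss_weight_add_2 power2_eq_square)
    have pos: "\<alpha> + 2 > 0" using assms(1) by simp
    have one: "(\<lambda>s. 1) \<in> gauss_L2 (\<alpha> + 2)" by (rule gauss_L2_const[OF pos])
    have half: "(\<lambda>s. 1/2 * s\<^sup>2) \<in> gauss_L2 \<alpha>" by (intro gauss_L2_cmult gauss_L2_square assms)
    \<comment> \<open>The mean of \<open>k\<close> for s^2 rho is the integral of s F. By parts
      against s^2/2 it becomes minus half the inner product of V with s^2, which vanishes by
      orthogonality.\<close>
    have "gauss_inner (\<alpha> + 2) ?k (\<lambda>s. 1) = integral {0<..} (\<lambda>s. s * F s)"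
      unfolding gauss_inner_def by (rule Henstock_Kurzweil_Integration.integral_cong[OF sF[symmetric]])
    also have "\<dots> = - integral {0<..} (\<lambda>s. (1/2 * s\<^sup>2) * (V s * gauss_weight \<alpha> s))"
    proof (rule gauss_parts[OF _ half F(1) _ _ _ C])
      show "ac_primitive (\<lambda>s. 1/2 * s\<^sup>2) (\<lambda>s. s)"
        by (rule ac_primitive_of_derivative) (auto intro!: derivative_eq_intros)
      show "continuous_on {0<..} (\<lambda>s. V s * gauss_weight \<alpha> s)"
        by (intro continuous_intros c gauss_weight_continuous)
      show "(\<lambda>s. s * F s) absolutely_integrable_on {0<..}"
        by (rule absolutely_integrable_spike[OF gauss_L2_mult[OF k(1) one], of "{}"]) (use sF in auto)
      show "(\<lambda>s. (1/2 * s\<^sup>2) * (V s * gauss_weight \<alpha> s)) absolutely_integrable_on {0<..}"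
        using gauss_L2_mult[OF half L2(1)] by (simp only: mult.assoc)
    qed
    also have "\<dots> = - gauss_inner \<alpha> (\<lambda>s. 1/2 * s\<^sup>2) V"
      by (simp only: gauss_inner_def mult.assoc)
    also have "\<dots> = 0"
      unfolding gauss_inner_cmult_left using orth gauss_inner_commute[of \<alpha> V] by simp
    finally have "2 * gauss_inner (\<alpha> + 2) ?k ?k \<le> gauss_inner (\<alpha> + 2) ?k' ?k'"
      by (rule gauss_Poincare[OF pos ac k])
    \<comment> \<open>Inserted in the dual identity this adds 2 to the coefficient 2 of the norm of
      \<open>k\<close>, so the dual inequality holds with 4.\<close>
    then show ?thesis
      by (intro gauss_energy_of_dual[OF V L2 F(1) C k(1)]) (use eq in auto)
  qed
qed

section \<open>Moments and splitting along 1 and s^2 - alpha\<close>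

lemma gauss_mass_pos:
  assumes "\<beta> > 0"
  shows "gauss_inner \<beta> (\<lambda>s. 1) (\<lambda>s. 1) > 0"
proof -
  have c: "continuous_on {1..2} (gauss_weight \<beta>)"
    by (rule continuous_on_subset[OF gauss_weight_continuous]) auto
  then obtain t where t: "t \<in> {1..2}" "\<And>s. s \<in> {1..2} \<Longrightarrow> gauss_weight \<beta> t \<le> gauss_weight \<beta> s"
    using continuous_attains_inf[OF _ _ c] by force
  have "0 < gauss_weight \<beta> t" using t by (intro gauss_weight_pos) auto
  also have "\<dots> = integral {1..2} (\<lambda>s::real. gauss_weight \<beta> t)" by simp
  also have "\<dots> \<le> integral {1..2} (gauss_weight \<beta>)"
    using t c by (intro integral_le integrable_continuous_real) auto
  also have "\<dots> \<le> integral {0<..} (gauss_weight \<beta>)"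
    using gauss_weight_absolutely_integrable[OF assms] c
    by (intro integral_subset_le integrable_continuous_real)
      (auto simp: absolutely_integrable_on_def gauss_weight_nonneg)
  finally show ?thesis by (simp add: gauss_inner_def)
qed

lemma ac_primitive_quadratic: "ac_primitive (\<lambda>s. a + b * s\<^sup>2) (\<lambda>s. 2 * b * s)"
  by (rule ac_primitive_of_derivative) (auto intro!: derivative_eq_intros continuous_intros)

text \<open>All moments come from \<open>gauss_inner_derivative_id\<close>, applied to the constant
  1 and to s^2, so only the total mass \<open>m\<close> remains and no Gamma values appear.\<close>

lemma gauss_moments:
  assumes "\<beta> > 0"
  defines "m \<equiv> gauss_inner \<beta> (\<lambda>s. 1) (\<lambda>s. 1)" and "e \<equiv> \<lambda>s. s\<^sup>2 - \<beta>"
  shows "gauss_inner \<beta> (\<lambda>s. s) (\<lambda>s. s) = \<beta> * m" "gauss_inner \<beta> e (\<lambda>s. 1) = 0"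
    "gauss_inner \<beta> e e = 2 * \<beta> * m"
proof -
  have 1: "(\<lambda>s. 1) \<in> gauss_L2 \<beta>" and s: "(\<lambda>s. s) \<in> gauss_L2 \<beta>" and s2: "(\<lambda>s. s\<^sup>2) \<in> gauss_L2 \<beta>"
    using assms(1) by (auto intro: gauss_L2_const gauss_L2_id gauss_L2_square)
  have e: "e = (\<lambda>s. s\<^sup>2 + (- \<beta>) * 1)" by (simp add: e_def)
  have eL: "e \<in> gauss_L2 \<beta>" unfolding e by (intro gauss_L2_add s2 gauss_L2_cmult 1)
  have m2: "gauss_inner \<beta> (\<lambda>s. 1) (\<lambda>s. s\<^sup>2) = \<beta> * m"
    using gauss_inner_derivative_id[OF assms(1) ac_primitive_quadratic[of 1 0]] 1 gauss_L2_const[OF assms(1), of 0]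
    by (simp add: m_def) (simp add: gauss_inner_def)
  then show ss: "gauss_inner \<beta> (\<lambda>s. s) (\<lambda>s. s) = \<beta> * m"
    by (simp add: gauss_inner_def power2_eq_square)
  have 2: "(\<lambda>s. 2 * s) \<in> gauss_L2 \<beta>" by (intro gauss_L2_cmult s)
  have "gauss_inner \<beta> (\<lambda>s. 2 * s) (\<lambda>s. s) = gauss_inner \<beta> (\<lambda>s. s\<^sup>2) (\<lambda>s. s\<^sup>2) - \<beta> * gauss_inner \<beta> (\<lambda>s. s\<^sup>2) (\<lambda>s. 1)"
    using gauss_inner_derivative_id[OF assms(1) ac_primitive_quadratic[of 0 1]] s2 2 by simp
  then have m4: "gauss_inner \<beta> (\<lambda>s. s\<^sup>2) (\<lambda>s. s\<^sup>2) = 2 * \<beta> * m + \<beta> * (\<beta> * m)"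
    unfolding gauss_inner_cmult_left ss gauss_inner_commute[of \<beta> "\<lambda>s. s\<^sup>2" "\<lambda>s. 1"] m2 by simp
  have "gauss_inner \<beta> e (\<lambda>s. 1) = gauss_inner \<beta> (\<lambda>s. s\<^sup>2) (\<lambda>s. 1) + (- \<beta>) * m"
    unfolding e gauss_inner_add_left[OF s2 gauss_L2_cmult[OF 1] 1] gauss_inner_cmult_left m_def ..
  then show "gauss_inner \<beta> e (\<lambda>s. 1) = 0"
    using m2 by (simp add: gauss_inner_commute[of \<beta> "\<lambda>s. s\<^sup>2" "\<lambda>s. 1"])
  show "gauss_inner \<beta> e e = 2 * \<beta> * m"
    unfolding e gauss_inner_linear_square[OF s2 1] m4
      gauss_inner_commute[of \<beta> "\<lambda>s. s\<^sup>2" "\<lambda>s. 1"] m2 m_def[symmetric]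
    by (simp add: power2_eq_square)
qed

text \<open>V = m + d (s^2 - alpha) + W with W orthogonal to 1 and s^2, and its derivative w = 2 d s
  + omega with omega orthogonal to s. Then \<open>A\<close> and \<open>K\<close> are the squared
  norms of W and omega, and the mixed terms drop out. The constant m - d alpha collects the part of
  s^2 - alpha that does not depend on s.\<close>

lemma gauss_decomposition:
  assumes "\<alpha> > 0" and V: "ac_primitive V w" and L2: "V \<in> gauss_L2 \<alpha>" "w \<in> gauss_L2 \<alpha>"
  defines "M \<equiv> \<alpha> * gauss_inner \<alpha> (\<lambda>s. 1) (\<lambda>s. 1)"
  obtains m d A K where
    "gauss_inner \<alpha> (\<lambda>s. V s - m) (\<lambda>s. V s - m) = A + 2 * M * d\<^sup>2"
    "\<And>t. gauss_inner \<alpha> (\<lambda>s. w s - t * s) (\<lambda>s. w s - t * s) = K + (2 * d - t)\<^sup>2 * M"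
    "gauss_inner \<alpha> (\<lambda>s. V s - (m - d * \<alpha>) - d * s\<^sup>2) (\<lambda>s. V s - (m - d * \<alpha>) - d * s\<^sup>2) = A"
    "4 * A \<le> K" "0 \<le> A"
proof -
  let ?p = "gauss_inner \<alpha>"
  define m0 where "m0 = ?p (\<lambda>s. 1) (\<lambda>s. 1)"
  define e where "e = (\<lambda>s. s\<^sup>2 - \<alpha>)"
  note mom = gauss_moments[OF assms(1), folded m0_def e_def]
  have M: "M = \<alpha> * m0" by (simp add: M_def m0_def)
  have pos: "m0 > 0" "M > 0" using gauss_mass_pos[OF assms(1)] assms(1) by (auto simp: m0_def M)
  have 1: "(\<lambda>s. 1) \<in> gauss_L2 \<alpha>" and s: "(\<lambda>s. s) \<in> gauss_L2 \<alpha>" and s2: "(\<lambda>s. s\<^sup>2) \<in> gauss_L2 \<alpha>"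
    using assms(1) by (auto intro: gauss_L2_const gauss_L2_id gauss_L2_square)
  have eL: "e \<in> gauss_L2 \<alpha>" unfolding e_def by (intro gauss_L2_diff s2 gauss_L2_const assms)
  \<comment> \<open>Coefficients of the orthogonal projection: the squared norms of 1 and
    \<open>e\<close> are \<open>m0\<close> and \<open>2 * M\<close>.\<close>
  define m d where "m = ?p V (\<lambda>s. 1) / m0" and "d = ?p V e / (2 * M)"
  define W where "W = (\<lambda>s. V s + (- m * 1 + (- d) * e s))"
  have cL: "(\<lambda>s. - m * 1 + (- d) * e s) \<in> gauss_L2 \<alpha>" by (intro gauss_L2_add gauss_L2_cmult 1 eL)
  have WL: "W \<in> gauss_L2 \<alpha>" unfolding W_def by (intro gauss_L2_add L2 cL)
  have Wi: "?p W f = ?p V f - m * ?p (\<lambda>s. 1) f - d * ?p e f" if "f \<in> gauss_L2 \<alpha>" for f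
    unfolding W_def gauss_inner_add_left[OF L2(1) cL that]
      gauss_inner_add_left[OF gauss_L2_cmult[OF 1] gauss_L2_cmult[OF eL] that] gauss_inner_cmult_left
    by simp
  have W1: "?p W (\<lambda>s. 1) = 0"
    using Wi[OF 1] mom(2) pos by (simp add: m_def flip: m0_def)
  have We: "?p W e = 0"
    using Wi[OF eL] mom pos assms(1) by (simp add: d_def gauss_inner_commute[of \<alpha> "\<lambda>s. 1" e] M)
  have "?p (\<lambda>s. e s + \<alpha> * 1) W = 0"
    unfolding gauss_inner_add_left[OF eL gauss_L2_cmult[OF 1] WL] gauss_inner_cmult_left
    using W1 We by (simp add: gauss_inner_commute[of \<alpha> _ W])
  then have Ws2: "?p W (\<lambda>s. s\<^sup>2) = 0"
    by (simp add: e_def gauss_inner_commute[of \<alpha> _ W])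
  define \<omega> where "\<omega> = (\<lambda>s. w s + (- 2 * d) * s)"
  have \<omega>L: "\<omega> \<in> gauss_L2 \<alpha>" unfolding \<omega>_def by (intro gauss_L2_add gauss_L2_cmult s L2)
  have acW: "ac_primitive W \<omega>"
    unfolding ac_primitive_def
  proof (intro allI impI conjI)
    fix a b :: real assume ab: "0 < a" "a \<le> b"
    note q = ac_primitiveD[OF ac_primitive_quadratic[of "- m + d * \<alpha>" "- d"] ab]
      and v = ac_primitiveD[OF V ab]
    have \<omega>: "\<omega> = (\<lambda>s. w s + 2 * (- d) * s)" by (simp add: \<omega>_def)
    then show "\<omega> absolutely_integrable_on {a..b}" using set_integral_add(1)[OF v(1) q(1)] by simp
    have "integral {a..b} \<omega> = integral {a..b} w + integral {a..b} (\<lambda>s. 2 * (- d) * s)"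
      unfolding \<omega> using v(1) q(1)
      by (intro Henstock_Kurzweil_Integration.integral_add; simp add: absolutely_integrable_on_def)
    then show "W b = W a + integral {a..b} \<omega>"
      using v(2) q(2) by (simp add: W_def e_def algebra_simps)
  qed
  \<comment> \<open>Differentiation preserves the splitting: \<open>W\<close> is orthogonal to 1 and
    s^2, so its derivative is orthogonal to s.\<close>
  have "?p \<omega> (\<lambda>s. s) = 0"
    using gauss_inner_derivative_id[OF assms(1) acW WL \<omega>L] W1 Ws2 by simp
  have "4 * ?p W W \<le> ?p \<omega> \<omega>"
    by (rule gauss_Poincare_orthogonal[OF assms(1) acW WL \<omega>L W1 Ws2])
  show ?thesis
  proof (rule that[of m "?p W W" d "?p \<omega> \<omega>"])
    have "(\<lambda>s. V s - m) = (\<lambda>s. W s + d * e s)" by (simp add: W_def)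
    then show "?p (\<lambda>s. V s - m) (\<lambda>s. V s - m) = ?p W W + 2 * M * d\<^sup>2"
      using gauss_inner_linear_square[OF WL eL, of d] We mom(3) by (simp add: M)
    show "?p (\<lambda>s. w s - t * s) (\<lambda>s. w s - t * s) = ?p \<omega> \<omega> + (2 * d - t)\<^sup>2 * M" for t
    proof -
      have "(\<lambda>s. w s - t * s) = (\<lambda>s. \<omega> s + (2 * d - t) * s)" by (simp add: \<omega>_def algebra_simps)
      then show ?thesis
        using gauss_inner_linear_square[OF \<omega>L s, of "2 * d - t"] \<open>?p \<omega> (\<lambda>s. s) = 0\<close> mom(1) by (simp add: M)
    qed
    have "(\<lambda>s. V s - (m - d * \<alpha>) - d * s\<^sup>2) = W" by (simp add: W_def e_def algebra_simps)
    then show "?p (\<lambda>s. V s - (m - d * \<alpha>) - d * s\<^sup>2) (\<lambda>s. V s - (m - d * \<alpha>) - d * s\<^sup>2) = ?p W W" by simp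
  qed (use \<open>4 * ?p W W \<le> ?p \<omega> \<omega>\<close> gauss_inner_nonneg[OF WL] in auto)
qed

section \<open>From inner products to the stated integrals\<close>

text \<open>Links the Lebesgue integral of the theorem with the inner product and allows
  \<open>g\<close> to be known only almost everywhere, as a Sobolev function and its weak derivative
  are.\<close>

lemma gauss_integral_square:
  assumes f: "f \<in> gauss_L2 \<beta>" and N: "negligible N" "\<And>s. s \<in> {0<..} - N \<Longrightarrow> g s = f s"
  shows "gauss_integral \<beta> (\<lambda>s. \<bar>g s\<bar>\<^sup>2) = gauss_inner \<beta> f f"
proof -
  have "(\<lambda>s. \<bar>g s\<bar>\<^sup>2 * gauss_weight \<beta> s) absolutely_integrable_on {0<..}"
    by (rule absolutely_integrable_spike[OF gauss_L2_mult[OF f f] N(1)])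
      (use N(2) in \<open>simp add: power2_eq_square\<close>)
  then have "gauss_integral \<beta> (\<lambda>s. \<bar>g s\<bar>\<^sup>2) = integral {0<..} (\<lambda>s. \<bar>g s\<bar>\<^sup>2 * gauss_weight \<beta> s)"
    unfolding gauss_integral_def by (rule set_lebesgue_integral_eq_integral(2))
  also have "\<dots> = gauss_inner \<beta> f f"
    unfolding gauss_inner_def by (rule integral_spike[OF N(1)]) (use N(2) in \<open>simp add: power2_eq_square\<close>)
  finally show ?thesis .
qed

lemma gauss_integral_nonneg: "(\<And>s. 0 \<le> f s) \<Longrightarrow> 0 \<le> gauss_integral \<beta> f"
  unfolding gauss_integral_def set_lebesgue_integral_def
  by (intro Bochner_Integration.integral_nonneg) (simp add: gauss_weight_nonneg)

text \<open>The finite energy is given for some weak derivative and is carried over to the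
  prescribed \<open>w\<close> by uniqueness.\<close>

lemma weighted_sobolev12_representative:
  assumes v: "v \<in> weighted_sobolev12 {0<..} (gauss_weight \<alpha>)" and w: "has_weak_derivative_on v w {0<..}"
  obtains V where "ac_primitive V w" "V \<in> gauss_L2 \<alpha>" "w \<in> gauss_L2 \<alpha>" "negligible {s \<in> {0<..}. v s \<noteq> V s}"
proof -
  obtain V where V: "ac_primitive V w" and N: "negligible {s \<in> {0<..}. v s \<noteq> V s}"
    by (rule weak_derivative_representative[OF w])
  obtain w' where w': "has_weak_derivative_on v w' {0<..}"
    and i: "(\<lambda>s. (\<bar>v s\<bar>\<^sup>2 + \<bar>w' s\<bar>\<^sup>2) * gauss_weight \<alpha> s) absolutely_integrable_on {0<..}"
    using v by (auto simp: weighted_sobolev12_def)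
  have "(\<lambda>s. (\<bar>V s\<bar>\<^sup>2 + \<bar>w s\<bar>\<^sup>2) * gauss_weight \<alpha> s) absolutely_integrable_on {0<..}"
    by (rule absolutely_integrable_spike[OF i negligible_Un[OF N weak_derivative_unique[OF w w']]]) auto
  then have int: "(\<lambda>s. ((V s)\<^sup>2 + (w s)\<^sup>2) * gauss_weight \<alpha> s) integrable_on {0<..}"
    by (simp add: absolutely_integrable_on_def)
  have "V \<in> gauss_L2 \<alpha>"
    by (rule gauss_L2_I[OF _ int])
      (auto intro!: continuous_imp_measurable_on_sets_lebesgue ac_primitive_continuous[OF V] mult_right_mono gauss_weight_nonneg)
  moreover have "w \<in> gauss_L2 \<alpha>"
    by (rule gauss_L2_I[OF ac_primitive_borel_measurable[OF V] int])
      (auto intro!: mult_right_mono gauss_weight_nonneg)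
  ultimately show ?thesis using that V N by blast
qed

lemma weighted_sobolev12_I:
  assumes "ac_primitive V w" "V \<in> gauss_L2 \<alpha>" "w \<in> gauss_L2 \<alpha>"
  shows "V \<in> weighted_sobolev12 {0<..} (gauss_weight \<alpha>)"
proof -
  have "(\<lambda>s. V s * V s * gauss_weight \<alpha> s + w s * w s * gauss_weight \<alpha> s) absolutely_integrable_on {0<..}"
    by (intro set_integral_add gauss_L2_mult assms)
  then have "(\<lambda>s. (\<bar>V s\<bar>\<^sup>2 + \<bar>w s\<bar>\<^sup>2) * gauss_weight \<alpha> s) absolutely_integrable_on {0<..}"
    by (simp add: power2_eq_square distrib_right)
  then show ?thesis
    using ac_primitive_has_weak_derivative[OF assms(1)] by (auto simp: weighted_sobolev12_def)
qed

text \<open>The energy is K + 4 d^2 M, and the choice c = m bounds the distance to constants by A +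
  2 d^2 M, so the multiples of d^2 M cancel in the deficit. What remains is K - 2A >= K/2 >= 2A, by
  4A <= K.\<close>

lemma gauss_stability:
  assumes "\<alpha> > 0" and v: "v \<in> weighted_sobolev12 {0<..} (gauss_weight \<alpha>)"
    and w: "has_weak_derivative_on v w {0<..}"
  shows "gauss_integral \<alpha> (\<lambda>s. \<bar>w s\<bar>\<^sup>2) - 2 * (INF c. gauss_integral \<alpha> (\<lambda>s. \<bar>v s - c\<bar>\<^sup>2))
      \<ge> 1 / 2 * (INF d. gauss_integral \<alpha> (\<lambda>s. \<bar>w s - d * s\<bar>\<^sup>2))" (is ?A)
    and "1 / 2 * (INF d. gauss_integral \<alpha> (\<lambda>s. \<bar>w s - d * s\<bar>\<^sup>2))
      \<ge> 2 * (INF (c, d)\<in>UNIV. gauss_integral \<alpha> (\<lambda>s. \<bar>v s - c - d * s\<^sup>2\<bar>\<^sup>2))" (is ?B)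
proof -
  obtain V where V: "ac_primitive V w" "V \<in> gauss_L2 \<alpha>" "w \<in> gauss_L2 \<alpha>"
    and N: "negligible {s \<in> {0<..}. v s \<noteq> V s}"
    by (rule weighted_sobolev12_representative[OF v w])
  define M where "M = \<alpha> * gauss_inner \<alpha> (\<lambda>s. 1) (\<lambda>s. 1)"
  have "M > 0" using gauss_mass_pos[OF assms(1)] assms(1) by (simp add: M_def)
  obtain m d A K where
    m: "gauss_inner \<alpha> (\<lambda>s. V s - m) (\<lambda>s. V s - m) = A + 2 * M * d\<^sup>2"
    and K: "\<And>t. gauss_inner \<alpha> (\<lambda>s. w s - t * s) (\<lambda>s. w s - t * s) = K + (2 * d - t)\<^sup>2 * M"
    and A: "gauss_inner \<alpha> (\<lambda>s. V s - (m - d * \<alpha>) - d * s\<^sup>2) (\<lambda>s. V s - (m - d * \<alpha>) - d * s\<^sup>2) = A"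
    and AK: "4 * A \<le> K" "0 \<le> A"
    by (rule gauss_decomposition[OF assms(1) V, folded M_def]) (rule that)
  have const: "(\<lambda>s. c) \<in> gauss_L2 \<alpha>" for c by (rule gauss_L2_const[OF assms(1)])
  have gm: "gauss_integral \<alpha> (\<lambda>s. \<bar>v s - m\<bar>\<^sup>2) = A + 2 * M * d\<^sup>2"
    unfolding m[symmetric]
    by (rule gauss_integral_square[OF _ N]) (auto intro!: gauss_L2_diff V const)
  have gK: "gauss_integral \<alpha> (\<lambda>s. \<bar>w s - t * s\<bar>\<^sup>2) = K + (2 * d - t)\<^sup>2 * M" for t
    unfolding K[symmetric]
    by (rule gauss_integral_square[OF _ negligible_empty])
      (auto intro!: gauss_L2_diff gauss_L2_cmult gauss_L2_id V assms)
  have gA: "gauss_integral \<alpha> (\<lambda>s. \<bar>v s - (m - d * \<alpha>) - d * s\<^sup>2\<bar>\<^sup>2) = A"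
    unfolding A[symmetric]
    by (rule gauss_integral_square[OF _ N])
      (auto intro!: gauss_L2_diff gauss_L2_cmult gauss_L2_square V assms const)
  have gw: "gauss_integral \<alpha> (\<lambda>s. \<bar>w s\<bar>\<^sup>2) = K + 4 * d\<^sup>2 * M"
    using gK[of 0] by (simp add: power_mult_distrib)
  have "(INF c. gauss_integral \<alpha> (\<lambda>s. \<bar>v s - c\<bar>\<^sup>2)) \<le> A + 2 * M * d\<^sup>2"
    unfolding gm[symmetric]
    by (intro cINF_lower bdd_belowI2[where m = 0] gauss_integral_nonneg) auto
  \<comment> \<open>Both directions matter: the upper bound for the first inequality, the lower
    bound for the second. For the other two infima an upper bound suffices.\<close>
  moreover have "(INF t. gauss_integral \<alpha> (\<lambda>s. \<bar>w s - t * s\<bar>\<^sup>2)) = K"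
  proof (rule antisym)
    have "(INF t. gauss_integral \<alpha> (\<lambda>s. \<bar>w s - t * s\<bar>\<^sup>2)) \<le> gauss_integral \<alpha> (\<lambda>s. \<bar>w s - (2 * d) * s\<bar>\<^sup>2)"
      by (intro cINF_lower bdd_belowI2[where m = 0] gauss_integral_nonneg) auto
    then show "(INF t. gauss_integral \<alpha> (\<lambda>s. \<bar>w s - t * s\<bar>\<^sup>2)) \<le> K" using gK[of "2 * d"] by simp
    show "K \<le> (INF t. gauss_integral \<alpha> (\<lambda>s. \<bar>w s - t * s\<bar>\<^sup>2))"
      unfolding gK by (rule cINF_greatest) (use \<open>M > 0\<close> in auto)
  qed
  moreover have "(INF (c, d)\<in>UNIV. gauss_integral \<alpha> (\<lambda>s. \<bar>v s - c - d * s\<^sup>2\<bar>\<^sup>2)) \<le> A"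
  proof -
    have "(INF (c, d)\<in>UNIV. gauss_integral \<alpha> (\<lambda>s. \<bar>v s - c - d * s\<^sup>2\<bar>\<^sup>2))
        \<le> (case (m - d * \<alpha>, d) of (c, d) \<Rightarrow> gauss_integral \<alpha> (\<lambda>s. \<bar>v s - c - d * s\<^sup>2\<bar>\<^sup>2))"
      by (intro cINF_lower bdd_belowI2[where m = 0]) (auto intro: gauss_integral_nonneg)
    then show ?thesis using gA by simp
  qed
  ultimately show ?A ?B using gw AK by (auto simp: algebra_simps)
qed

theorem theorem2p1:
  fixes \<alpha> :: real
  assumes "\<alpha> > 0"
  defines "W \<equiv> weighted_sobolev12 {0<..} (gauss_weight \<alpha>)"
  shows
    "(\<forall>v\<in>W. \<forall>v'. has_weak_derivative_on v v' {0<..} \<longrightarrow>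
        gauss_integral \<alpha> (\<lambda>s. \<bar>v' s\<bar>\<^sup>2)
          \<ge> 2 * (INF c. gauss_integral \<alpha> (\<lambda>s. \<bar>v s - c\<bar>\<^sup>2)))
   \<and> (\<forall>C. (\<forall>v\<in>W. \<forall>v'. has_weak_derivative_on v v' {0<..} \<longrightarrow>
        gauss_integral \<alpha> (\<lambda>s. \<bar>v' s\<bar>\<^sup>2)
          \<ge> C * (INF c. gauss_integral \<alpha> (\<lambda>s. \<bar>v s - c\<bar>\<^sup>2))) \<longrightarrow> C \<le> 2)
   \<and> (\<forall>a\<^sub>0 a\<^sub>1 :: real. (\<lambda>s. a\<^sub>0 + a\<^sub>1 * s\<^sup>2) \<in> W \<and>
        (\<forall>v'. has_weak_derivative_on (\<lambda>s. a\<^sub>0 + a\<^sub>1 * s\<^sup>2) v' {0<..} \<longrightarrow>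
        gauss_integral \<alpha> (\<lambda>s. \<bar>v' s\<bar>\<^sup>2)
          = 2 * (INF c. gauss_integral \<alpha> (\<lambda>s. \<bar>(a\<^sub>0 + a\<^sub>1 * s\<^sup>2) - c\<bar>\<^sup>2))))
   \<and> (\<forall>v\<in>W. \<forall>v'. has_weak_derivative_on v v' {0<..} \<longrightarrow>
        gauss_integral \<alpha> (\<lambda>s. \<bar>v' s\<bar>\<^sup>2)
          - 2 * (INF c. gauss_integral \<alpha> (\<lambda>s. \<bar>v s - c\<bar>\<^sup>2))
          \<ge> 1 / 2 * (INF d. gauss_integral \<alpha> (\<lambda>s. \<bar>v' s - d * s\<bar>\<^sup>2))
      \<and> 1 / 2 * (INF d. gauss_integral \<alpha> (\<lambda>s. \<bar>v' s - d * s\<bar>\<^sup>2))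
          \<ge> 2 * (INF (c, d)\<in>UNIV. gauss_integral \<alpha> (\<lambda>s. \<bar>v s - c - d * s\<^sup>2\<bar>\<^sup>2)))"
proof -
  define M where "M = \<alpha> * gauss_inner \<alpha> (\<lambda>s. 1) (\<lambda>s. 1)"
  have "M > 0" using gauss_mass_pos[OF assms(1)] assms(1) by (simp add: M_def)
  note stab = gauss_stability[OF assms(1), folded W_def]
  have INF_nonneg: "0 \<le> (INF d. gauss_integral \<alpha> (\<lambda>s. \<bar>v' s - d * s\<bar>\<^sup>2))" for v'
    by (rule cINF_greatest) (auto intro: gauss_integral_nonneg)
  \<comment> \<open>The energy 4 b^2 M is twice the squared distance 2 b^2 M to the constants: this
    is equality, and with b = 1 also sharpness.\<close>
  have quad: "(\<lambda>s. a + b * s\<^sup>2) \<in> W"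
    "has_weak_derivative_on (\<lambda>s. a + b * s\<^sup>2) (\<lambda>s. 2 * b * s) {0<..}"
    "has_weak_derivative_on (\<lambda>s. a + b * s\<^sup>2) v' {0<..} \<Longrightarrow> gauss_integral \<alpha> (\<lambda>s. \<bar>v' s\<bar>\<^sup>2) = 4 * b\<^sup>2 * M"
    "(INF c. gauss_integral \<alpha> (\<lambda>s. \<bar>(a + b * s\<^sup>2) - c\<bar>\<^sup>2)) = 2 * b\<^sup>2 * M" for a b v'
  proof -
    note ac = ac_primitive_quadratic[of a b]
    have wL: "(\<lambda>s. 2 * b * s) \<in> gauss_L2 \<alpha>" by (intro gauss_L2_cmult gauss_L2_id assms)
    have 1: "(\<lambda>s. 1) \<in> gauss_L2 \<alpha>" by (intro gauss_L2_const assms)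
    have eL: "(\<lambda>s. s\<^sup>2 - \<alpha>) \<in> gauss_L2 \<alpha>"
      by (intro gauss_L2_diff gauss_L2_const gauss_L2_square assms)
    show "(\<lambda>s. a + b * s\<^sup>2) \<in> W"
      unfolding W_def
      by (rule weighted_sobolev12_I[OF ac _ wL])
        (intro gauss_L2_add gauss_L2_cmult gauss_L2_const gauss_L2_square assms)
    show wd: "has_weak_derivative_on (\<lambda>s. a + b * s\<^sup>2) (\<lambda>s. 2 * b * s) {0<..}"
      by (rule ac_primitive_has_weak_derivative[OF ac])
    show "gauss_integral \<alpha> (\<lambda>s. \<bar>v' s\<bar>\<^sup>2) = 4 * b\<^sup>2 * M"
      if "has_weak_derivative_on (\<lambda>s. a + b * s\<^sup>2) v' {0<..}"
    proof -
      have "gauss_integral \<alpha> (\<lambda>s. \<bar>v' s\<bar>\<^sup>2) = gauss_inner \<alpha> (\<lambda>s. 2 * b * s) (\<lambda>s. 2 * b * s)"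
        by (rule gauss_integral_square[OF wL weak_derivative_unique[OF that wd]]) auto
      also have "\<dots> = 4 * b\<^sup>2 * M"
        using gauss_inner_linear_square[OF gauss_L2_const[OF assms(1), of 0] gauss_L2_id[OF assms(1)], of "2 * b"]
          gauss_moments(1)[OF assms(1)]
        by (simp add: M_def power_mult_distrib) (simp add: gauss_inner_def)
      finally show ?thesis .
    qed
    \<comment> \<open>The quadratic is centred at its mean a + b alpha; the remainder b (s^2 -
      alpha) is orthogonal to constants, so the mixed term vanishes.\<close>
    have val: "gauss_integral \<alpha> (\<lambda>s. \<bar>(a + b * s\<^sup>2) - c\<bar>\<^sup>2) =
        2 * b\<^sup>2 * M + (a + b * \<alpha> - c)\<^sup>2 * gauss_inner \<alpha> (\<lambda>s. 1) (\<lambda>s. 1)" for c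
    proof -
      let ?f = "\<lambda>s. b * (s\<^sup>2 - \<alpha>) + (a + b * \<alpha> - c) * 1"
      have "gauss_integral \<alpha> (\<lambda>s. \<bar>(a + b * s\<^sup>2) - c\<bar>\<^sup>2) = gauss_inner \<alpha> ?f ?f"
        by (rule gauss_integral_square[OF _ negligible_empty])
          (intro gauss_L2_add gauss_L2_cmult eL 1, simp add: algebra_simps)
      also have "\<dots> = 2 * b\<^sup>2 * M + (a + b * \<alpha> - c)\<^sup>2 * gauss_inner \<alpha> (\<lambda>s. 1) (\<lambda>s. 1)"
        unfolding gauss_inner_linear_square[OF gauss_L2_cmult[OF eL] 1] gauss_inner_cmult_left
          gauss_inner_commute[of \<alpha> _ "\<lambda>s. b * (s\<^sup>2 - \<alpha>)"]
        using gauss_moments(2,3)[OF assms(1)]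
        by (simp add: gauss_inner_cmult_left gauss_inner_commute[of \<alpha> _ "\<lambda>s. b * (s\<^sup>2 - \<alpha>)"] M_def power2_eq_square)
      finally show ?thesis .
    qed
    show "(INF c. gauss_integral \<alpha> (\<lambda>s. \<bar>(a + b * s\<^sup>2) - c\<bar>\<^sup>2)) = 2 * b\<^sup>2 * M"
    proof (rule antisym)
      have "(INF c. gauss_integral \<alpha> (\<lambda>s. \<bar>(a + b * s\<^sup>2) - c\<bar>\<^sup>2))
          \<le> gauss_integral \<alpha> (\<lambda>s. \<bar>(a + b * s\<^sup>2) - (a + b * \<alpha>)\<bar>\<^sup>2)"
        by (intro cINF_lower bdd_belowI2[where m = 0] gauss_integral_nonneg) auto
      also have "\<dots> = 2 * b\<^sup>2 * M" unfolding val by simp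
      finally show "(INF c. gauss_integral \<alpha> (\<lambda>s. \<bar>(a + b * s\<^sup>2) - c\<bar>\<^sup>2)) \<le> 2 * b\<^sup>2 * M" .
      show "2 * b\<^sup>2 * M \<le> (INF c. gauss_integral \<alpha> (\<lambda>s. \<bar>(a + b * s\<^sup>2) - c\<bar>\<^sup>2))"
        unfolding val by (rule cINF_greatest) (use gauss_mass_pos[OF assms(1)] in auto)
    qed
  qed
  show ?thesis
  proof (intro conjI ballI allI impI)
    fix v v' assume "v \<in> W" "has_weak_derivative_on v v' {0<..}"
    \<comment> \<open>The gap 2 follows from the stability estimate, whose lower bound for the
      deficit is nonnegative.\<close>
    then show "2 * (INF c. gauss_integral \<alpha> (\<lambda>s. \<bar>v s - c\<bar>\<^sup>2)) \<le> gauss_integral \<alpha> (\<lambda>s. \<bar>v' s\<bar>\<^sup>2)"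
      using stab(1) INF_nonneg[of v'] by fastforce
  next
    fix C assume "\<forall>v\<in>W. \<forall>v'. has_weak_derivative_on v v' {0<..} \<longrightarrow>
      C * (INF c. gauss_integral \<alpha> (\<lambda>s. \<bar>v s - c\<bar>\<^sup>2)) \<le> gauss_integral \<alpha> (\<lambda>s. \<bar>v' s\<bar>\<^sup>2)"
    \<comment> \<open>The function s^2 has energy 4M and squared distance 2M from the constants,
      with M positive.\<close>
    from this[rule_format, OF quad(1,2)[of 0 1]] have "C * (2 * M) \<le> 4 * M"
      using quad(3)[OF quad(2)[of 0 1]] quad(4)[of 0 1] by simp
    then show "C \<le> 2" using \<open>M > 0\<close> by simp
  qed (use quad stab in auto)
qed

end
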